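(* Let $n\ge 1$ and let $\phi,\psi\in M_n(L^\infty)$. Assume that $P(\overline z\,\phi^*(z))$ is regular. Then $H_\psi T_\phi=T_\phi^*H_\psi^*$ on $H^2_n$ if and only if there exists $A\in M_n(\mathbb{C})$ such that the following hold: (i) $\psi(z)+\widetilde\phi(z)A^*$ is analytic; (ii) $\widetilde\psi(z)-A^*\phi(z)$ is analytic; (iii) $\widetilde\phi(z)A\phi(z)$ is analytic.
   Context: $L^2,L^\infty$ are the square-integrable and essentially bounded functions on the unit circle $\mathbb{T}$ (normalized Lebesgue measure); $H^2\subset L^2$ is the closed subspace of functions whose negative Fourier coefficients vanish. $M_n(L^\infty)$ is the set of $n\times n$ matrices with entries in $L^\infty$, regarded as matrix-valued functions on $\mathbb{T}$. $H^2_n=\bigoplus_1^n H^2$ is the $\mathbb{C}^n$-valued Hardy space. $P$ denotes the orthogonal projection of $L^2$ onto $H^2$, applied entrywise to vector- and matrix-valued functions. For $F\in M_n(L^\infty)$, the Toeplitz operator $T_F:H^2_n\to H^2_n$ is $T_F(h)(z)=P(F(z)h(z))$ and the Hankel operator $H_F:H^2_n\to H^2_n$ is $H_F(h)(z)=P(\overline z F(\overline z)h(\overline z))$. $F^*$ is the pointwise adjoint of $F$, and $\widetilde F(z)=F^*(\overline z)$. A matrix-valued function on $\mathbb{T}$ is analytic if all its Fourier coefficients of negative index vanish. An $m\times m$ matrix-valued function with entries in $L^2$ is called regular if its $m$ column vectors are linearly independent in $L^2_m$, the space of $\mathbb{C}^m$-valued $L^2$ functions. *)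

theory Defs
  imports "HOL-Analysis.Analysis"
begin

(* Elements of the function spaces below are represented by actual functions; two functions denote
   the same element iff they agree almost everywhere on the circle.  All equalities between
   elements of these spaces are therefore stated with "AE z in circle". *)

text \<open>Normalized Lebesgue (arc length) measure, with the unit circle as underlying space.\<close>

definition circle :: "complex measure" where
  "circle = distr (uniform_measure lborel {0..<2 * pi}) (restrict_space borel (sphere 0 1)) cis"

definition Ltwo :: "(complex \<Rightarrow> complex) set" where
  "Ltwo = {f. f \<in> borel_measurable circle \<and> integrable circle (\<lambda>z. (norm (f z))\<^sup>2)}"

definition Linf :: "(complex \<Rightarrow> complex) set" where
  "Linf = {f. f \<in> borel_measurable circle \<and> (\<exists>C. AE z in circle. norm (f z) \<le> C)}"

definition fourier_coeff :: "(complex \<Rightarrow> complex) \<Rightarrow> int \<Rightarrow> complex" where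
  "fourier_coeff f k = (LINT z|circle. f z * z powi (- k))"

definition Htwo :: "(complex \<Rightarrow> complex) set" where
  "Htwo = {f \<in> Ltwo. \<forall>k<0. fourier_coeff f k = 0}"

definition Ltwo_inner :: "(complex \<Rightarrow> complex) \<Rightarrow> (complex \<Rightarrow> complex) \<Rightarrow> complex" where
  "Ltwo_inner f g = (LINT z|circle. f z * cnj (g z))"

text \<open>The orthogonal projection of \<open>L\<^sup>2\<close> onto \<open>H\<^sup>2\<close>: for \<open>f\<close> in \<open>L\<^sup>2\<close>, a representative of the
  (up to null sets unique) element \<open>g\<close> of \<open>H\<^sup>2\<close> with \<open>f - g\<close> orthogonal to \<open>H\<^sup>2\<close>.\<close>

definition hardy_proj :: "(complex \<Rightarrow> complex) \<Rightarrow> (complex \<Rightarrow> complex)" where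
  "hardy_proj f = (SOME g. g \<in> Htwo \<and> (\<forall>h\<in>Htwo. Ltwo_inner (\<lambda>z. f z - g z) h = 0))"

definition hardy_proj_vec :: "(complex \<Rightarrow> complex ^ 'n) \<Rightarrow> (complex \<Rightarrow> complex ^ 'n)" where
  "hardy_proj_vec f = (\<lambda>z. \<chi> i. hardy_proj (\<lambda>w. f w $ i) z)"

definition hardy_proj_mat ::
    "(complex \<Rightarrow> complex ^ 'n ^ 'm) \<Rightarrow> (complex \<Rightarrow> complex ^ 'n ^ 'm)" where
  "hardy_proj_mat F = (\<lambda>z. \<chi> i j. hardy_proj (\<lambda>w. F w $ i $ j) z)"

definition Linf_mat :: "(complex \<Rightarrow> complex ^ 'n ^ 'n) set" where
  "Linf_mat = {F. \<forall>i j. (\<lambda>z. F z $ i $ j) \<in> Linf}"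

definition Htwo_vec :: "(complex \<Rightarrow> complex ^ 'n) set" where
  "Htwo_vec = {h. \<forall>i. (\<lambda>z. h z $ i) \<in> Htwo}"

definition Ltwo_vec_inner ::
    "(complex \<Rightarrow> complex ^ 'n) \<Rightarrow> (complex \<Rightarrow> complex ^ 'n) \<Rightarrow> complex" where
  "Ltwo_vec_inner f g = (\<Sum>i\<in>UNIV. Ltwo_inner (\<lambda>z. f z $ i) (\<lambda>z. g z $ i))"

definition mat_adj :: "complex ^ 'n ^ 'm \<Rightarrow> complex ^ 'm ^ 'n" where
  "mat_adj A = (\<chi> i j. cnj (A $ j $ i))"

definition fun_tilde :: "(complex \<Rightarrow> complex ^ 'n ^ 'n) \<Rightarrow> (complex \<Rightarrow> complex ^ 'n ^ 'n)" where
  "fun_tilde F = (\<lambda>z. mat_adj (F (cnj z)))"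

definition toeplitz ::
    "(complex \<Rightarrow> complex ^ 'n ^ 'n) \<Rightarrow> (complex \<Rightarrow> complex ^ 'n) \<Rightarrow> (complex \<Rightarrow> complex ^ 'n)" where
  "toeplitz F h = hardy_proj_vec (\<lambda>z. F z *v h z)"

definition hankel ::
    "(complex \<Rightarrow> complex ^ 'n ^ 'n) \<Rightarrow> (complex \<Rightarrow> complex ^ 'n) \<Rightarrow> (complex \<Rightarrow> complex ^ 'n)" where
  "hankel F h = hardy_proj_vec (\<lambda>z. cnj z *s (F (cnj z) *v h (cnj z)))"

text \<open>The Hilbert space adjoint of an operator \<open>T\<close> on \<open>H\<^sup>2\<^sub>n\<close>.  For a bounded linear \<open>T\<close> and \<open>h\<close>
  in \<open>H\<^sup>2\<^sub>n\<close>, the chosen \<open>k\<close> exists and is unique up to null sets.  (The library's \<open>adjoint\<close> is about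
  real inner products on a type and does not apply here.)\<close>

definition hardy_adjoint ::
    "((complex \<Rightarrow> complex ^ 'n) \<Rightarrow> (complex \<Rightarrow> complex ^ 'n)) \<Rightarrow>
     (complex \<Rightarrow> complex ^ 'n) \<Rightarrow> (complex \<Rightarrow> complex ^ 'n)" where
  "hardy_adjoint T h =
     (SOME k. k \<in> Htwo_vec \<and> (\<forall>g\<in>Htwo_vec. Ltwo_vec_inner (T g) h = Ltwo_vec_inner g k))"

text \<open>Integrability is required because the Bochner integral of a non-integrable function is 0 by
  convention, so that vanishing of \<open>fourier_coeff\<close> would otherwise be meaningless.\<close>

definition analytic_mat :: "(complex \<Rightarrow> complex ^ 'n ^ 'm) \<Rightarrow> bool" where
  "analytic_mat F \<longleftrightarrow>
     (\<forall>i j. integrable circle (\<lambda>z. F z $ i $ j) \<and>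
            (\<forall>k<0. fourier_coeff (\<lambda>z. F z $ i $ j) k = 0))"

definition regular_mat :: "(complex \<Rightarrow> complex ^ 'm ^ 'm) \<Rightarrow> bool" where
  "regular_mat F \<longleftrightarrow>
     (\<forall>i j. (\<lambda>z. F z $ i $ j) \<in> Ltwo) \<and>
     (\<forall>c :: 'm \<Rightarrow> complex.
        (AE z in circle. (\<Sum>j\<in>UNIV. c j *s column j (F z)) = 0) \<longrightarrow> (\<forall>j. c j = 0))"

end

theory Submission
  imports Defs
begin

text \<open>
  Write \<open>a\<^sub>k\<close>, \<open>b\<^sub>k\<close> for the Fourier coefficients of \<open>\<phi>\<close>, \<open>\<psi>\<close> of index \<open>- k - 1\<close>, \<open>k \<ge> 0\<close>.  The
  adjoint of \<open>T\<^sub>\<phi>\<close> has symbol \<open>\<phi>\<^sup>*\<close>, that of \<open>H\<^sub>\<psi>\<close> has symbol \<open>fun_tilde \<psi>\<close>.  Replacing \<open>h\<close> by \<open>z h\<close>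
  shifts the coefficients of both products \<open>H\<^sub>\<psi> T\<^sub>\<phi> h\<close> and \<open>T\<^sub>\<phi>\<^sup>* H\<^sub>\<psi>\<^sup>* h\<close> up to one boundary term each;
  if the products agree, then so do the boundary terms, which says
  \<open>b\<^sub>l a\<^sub>k + a\<^sub>l\<^sup>* b\<^sub>k\<^sup>* = 0\<close> for all \<open>k\<close>, \<open>l\<close>.  Regularity means that no nonzero vector is killed by
  all \<open>a\<^sub>k\<^sup>*\<close>, so this system forces \<open>b\<^sub>l = a\<^sub>l\<^sup>* A\<close> with a single skew-adjoint \<open>A\<close>, which is (i) and (ii).
  Conversely (i) and (ii) give such a factorization, with \<open>A\<close> skew-adjoint by regularity.  Given the
  factorization, the difference of the two products is the Hankel operator with symbol
  \<open>fun_tilde \<phi> A \<phi>\<close>, which vanishes if and only if (iii) holds.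
\<close>

section \<open>Normalized arc length\<close>

text \<open>Projections and adjoints are picked by \<open>SOME\<close> and fixed only up to null
  sets, so only their Fourier coefficients are accessible. Hence the analytic groundwork:
  completeness of L2 supplies the projection, and uniqueness of coefficients turns coefficient
  identities into equality almost everywhere. A function is expanded under a symbol only when its
  spectrum lies on one side of the gap between -1 and 0; every product then becomes a series over
  \<open>nat\<close>. A function with two-sided spectrum is split first. The boundary terms come
  from the coefficient that multiplication by \<open>z\<close> carries across that gap: Hankel
  entries depend on \<open>l + m\<close> and Toeplitz entries on \<open>l - m\<close>, so all other
  terms merely move by one row. Regularity enters because \<open>mat_adj\<close> of
  \<open>a\<^sub>k\<close> is the coefficient of index \<open>k\<close> of the function that is
  projected. Substituting the factorization into the boundary equation leaves
  \<open>A + mat_adj A\<close> between an adjoint on the left and some \<open>a\<^sub>k\<close> on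
  the right; triviality of the common kernel removes the two factors one after the other.\<close>

lemma space_circle [simp]: "space circle = sphere 0 1"
  by (simp add: circle_def space_restrict_space)

lemma sets_circle [measurable_cong]: "sets circle = sets (restrict_space borel (sphere 0 1))"
  by (simp add: circle_def)

lemma borel_measurable_circleI: "f \<in> borel_measurable borel \<Longrightarrow> f \<in> borel_measurable circle"
  by (subst measurable_cong_sets[OF sets_circle refl]) (rule measurable_restrict_space1)

lemma continuous_borel_measurable_circle:
  "continuous_on (sphere 0 1) f \<Longrightarrow> f \<in> borel_measurable circle"
  by (subst measurable_cong_sets[OF sets_circle refl]) (rule borel_measurable_continuous_on_restrict)

lemma measurable_cis_circle:
  "cis \<in> measurable (uniform_measure lborel {0..<2 * pi}) (restrict_space borel (sphere 0 1))"
proof -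
  have "continuous_on UNIV cis"
    by (intro continuous_intros)
  then have "cis \<in> borel_measurable borel"
    by (rule borel_measurable_continuous_onI)
  then show ?thesis
    by (auto intro!: measurable_restrict_space2 simp: measurable_cong_sets[OF sets_uniform_measure])
qed

interpretation circle: finite_measure circle
proof
  have "sphere 0 1 \<in> sets (restrict_space borel (sphere (0::complex) 1))"
    using sets.top[of "restrict_space borel (sphere (0::complex) 1)"]
    by (simp add: space_restrict_space)
  then have "emeasure circle (space circle) = 1"
    unfolding circle_def
    using measurable_cis_circle
    by (subst emeasure_distr)
       (auto simp: space_restrict_space vimage_def emeasure_uniform_measure_1)
  then show "emeasure circle (space circle) \<noteq> \<infinity>" by simp
qed

lemma emeasure_circle:
  assumes "A \<in> sets circle"
  shows "emeasure circle A = emeasure lborel ({0..<2 * pi} \<inter> cis -` A) / ennreal (2 * pi)"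
proof -
  have "emeasure circle A = emeasure (uniform_measure lborel {0..<2 * pi}) (cis -` A)"
    using assms measurable_cis_circle unfolding circle_def by (subst emeasure_distr) auto
  also have "cis -` A \<in> sets borel"
    using measurable_sets[OF measurable_cis_circle, of A] assms by (simp add: circle_def)
  ultimately show ?thesis
    by simp
qed

text \<open>The half-open interval comes from the definition of \<open>circle\<close>, the closed
  one suits the fundamental theorem of calculus; they differ in the null point
  \<open>2 * pi\<close>.\<close>

lemma integral_circle:
  fixes f :: "complex \<Rightarrow> complex"
  assumes "f \<in> borel_measurable circle"
  shows "(LINT z|circle. f z) =
    (LINT t|lborel. indicator {0..2 * pi} t *\<^sub>R f (cis t)) / (2 * pi)"
proof -
  have m: "f \<in> borel_measurable (restrict_space borel (sphere 0 1))"
    using assms measurable_cong_sets[OF sets_circle refl] by metis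
  have u: "uniform_measure lborel {0..<2 * pi} =
      density lborel (\<lambda>t. ennreal (indicator {0..<2 * pi} t / (2 * pi)))"
    unfolding uniform_measure_def
    by (intro density_cong) (auto simp: divide_ennreal indicator_def simp flip: ennreal_1)
  have mf: "(\<lambda>t. f (cis t)) \<in> borel_measurable lborel"
    using measurable_compose[OF measurable_cis_circle m] by simp
  have "(LINT z|circle. f z) = (LINT t|uniform_measure lborel {0..<2 * pi}. f (cis t))"
    unfolding circle_def by (rule integral_distr[OF measurable_cis_circle m])
  also have "\<dots> = (LINT t|lborel. (indicator {0..<2 * pi} t / (2 * pi)) *\<^sub>R f (cis t))"
    unfolding u by (rule integral_density) (use mf in auto)
  also have "\<dots> = (LINT t|lborel. (indicator {0..2 * pi} t *\<^sub>R f (cis t)) / (2 * pi))"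
  proof (rule integral_cong_AE)
    have "AE t in lborel. t \<noteq> 2 * pi"
      by (rule AE_lborel_singleton)
    then show "AE t in lborel. (indicator {0..<2 * pi} t / (2 * pi)) *\<^sub>R f (cis t) =
        (indicator {0..2 * pi} t *\<^sub>R f (cis t)) / (2 * pi)"
      by eventually_elim (auto simp: indicator_def scaleR_conv_of_real)
  qed (use mf in measurable)
  finally show ?thesis by simp
qed

lemma integral_circle_powi:
  "(LINT z|circle. z powi n) = (if n = 0 then 1 else 0)"
proof -
  have m: "(\<lambda>z. z powi n) \<in> borel_measurable circle"
    by (rule continuous_borel_measurable_circle) (auto intro!: continuous_intros)
  have c: "cis t powi n = cis (of_int n * t)" for t
    by (simp add: cis_power_int)
  have I: "(LINT t|lborel. indicator {0..2 * pi} t *\<^sub>R cis (of_int n * t)) = 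
     (if n = 0 then 2 * pi else 0)"
  proof (cases "n = 0")
    case True
    then show ?thesis by (simp add: scaleR_conv_of_real)
  next
    case False
    define F where "F = (\<lambda>t. cis (of_int n * t) / (\<i> * of_int n))"
    have "(LINT t|lborel. indicator {0..2 * pi} t *\<^sub>R cis (of_int n * t)) = F (2 * pi) - F 0"
    proof (rule integral_FTC_atLeastAtMost)
      show "(F has_vector_derivative cis (of_int n * t)) (at t within {0..2 * pi})" for t
      proof -
        \<comment> \<open>The antiderivative is differentiated as an entire function and then
          restricted to the real line.\<close>
        have "((\<lambda>z. exp (\<i> * (of_int n * z)) / (\<i> * of_int n)) has_field_derivative
            exp (\<i> * (of_int n * of_real t))) (at (of_real t))"
          using False by (auto intro!: derivative_eq_intros simp: mult.left_commute mult.commute[of _ "\<i>"])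
        from has_vector_derivative_real_field[OF this] show ?thesis
          by (simp add: F_def cis_conv_exp)
      qed
    qed (auto intro!: continuous_intros)
    also have "F (2 * pi) = F 0"
      using cis_multiple_2pi[of "of_int n"] by (simp add: F_def mult_ac)
    finally show ?thesis using False by simp
  qed
  show ?thesis
    by (subst integral_circle[OF m]) (simp add: c I)
qed

lemma measurable_cnj_circle [measurable]: "cnj \<in> measurable circle circle"
proof -
  have "cnj \<in> borel_measurable borel"
    by (intro borel_measurable_continuous_onI continuous_intros)
  then have "cnj \<in> measurable (restrict_space borel (sphere 0 1)) (restrict_space borel (sphere 0 1))"
    by (auto intro!: measurable_restrict_space3)
  then show ?thesis
    using measurable_cong_sets[OF sets_circle sets_circle] by metis
qed

text \<open>In the angle, conjugation is \<open>t\<close> to \<open>2 * pi - t\<close>, a reflection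
  followed by a translation, both of which preserve Lebesgue measure. The half-open interval comes
  back open at the other end, a change on a null set.\<close>

lemma distr_circle_cnj: "distr circle circle cnj = circle"
proof (rule measure_eqI)
  fix A assume "A \<in> sets (distr circle circle cnj)"
  then have A: "A \<in> sets circle" by simp
  have cA: "cnj -` A \<inter> space circle \<in> sets circle"
    using A by measurable
  have bA: "cis -` A \<in> sets borel" if "A \<in> sets circle" for A
    using measurable_sets[OF measurable_cis_circle, of A] that by (simp add: circle_def)
  have "emeasure (distr circle circle cnj) A = emeasure circle (cnj -` A \<inter> space circle)"
    using A by (simp add: emeasure_distr)
  also have "\<dots> = emeasure lborel ({0..<2 * pi} \<inter> cis -` (cnj -` A \<inter> space circle)) / ennreal (2 * pi)"
    by (rule emeasure_circle[OF cA])
  also have "emeasure lborel ({0..<2 * pi} \<inter> cis -` (cnj -` A \<inter> space circle)) =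
     emeasure (distr (distr lborel borel uminus) borel ((+) (2 * pi))) ({0..<2 * pi} \<inter> cis -` (cnj -` A \<inter> space circle))"
    by (simp add: lborel_distr_uminus lborel_distr_plus)
  also have "\<dots> = emeasure lborel ((\<lambda>t. 2 * pi - t) -` ({0..<2 * pi} \<inter> cis -` (cnj -` A \<inter> space circle)))"
    using bA[OF cA] by (simp add: distr_distr emeasure_distr comp_def)
  also have "(\<lambda>t. 2 * pi - t) -` ({0..<2 * pi} \<inter> cis -` (cnj -` A \<inter> space circle)) =
     {0<..2 * pi} \<inter> cis -` A"
  proof -
    have "cis (2 * pi - t) = cnj (cis t)" for t
      using cis_divide[of "2 * pi" t] by (simp add: cis_cnj cis_inverse divide_inverse)
    then show ?thesis by auto
  qed
  also have "emeasure lborel ({0<..2 * pi} \<inter> cis -` A) = emeasure lborel ({0..<2 * pi} \<inter> cis -` A)"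
  proof (rule emeasure_eq_AE)
    show "AE t in lborel. t \<in> {0<..2 * pi} \<inter> cis -` A \<longleftrightarrow> t \<in> {0..<2 * pi} \<inter> cis -` A"
      using AE_lborel_singleton[of 0] AE_lborel_singleton[of "2 * pi"]
      by eventually_elim auto
  qed (use bA[OF A] in auto)
  also have "\<dots> / ennreal (2 * pi) = emeasure circle A"
    using emeasure_circle[OF A] by simp
  finally show "emeasure (distr circle circle cnj) A = emeasure circle A" .
qed simp

lemma integrable_circle_cnj:
  fixes f :: "complex \<Rightarrow> 'a::{banach, second_countable_topology}"
  shows "integrable circle f \<Longrightarrow> integrable circle (\<lambda>z. f (cnj z))"
  using integrable_distr[OF measurable_cnj_circle, of f] by (simp add: distr_circle_cnj)

lemma integral_circle_cnj:
  fixes f :: "complex \<Rightarrow> 'a::{banach, second_countable_topology}"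
  assumes "f \<in> borel_measurable circle"
  shows "(LINT z|circle. f (cnj z)) = (LINT z|circle. f z)"
  using integral_distr[OF measurable_cnj_circle assms] by (simp add: distr_circle_cnj)

section \<open>Uniqueness of Fourier coefficients\<close>

lemma cnj_eq_inverse_circle: "norm z = 1 \<Longrightarrow> cnj z = inverse z"
  using complex_norm_square[of z] inverse_unique[of z "cnj z"] by simp

lemma powi_add_circle: "norm z = 1 \<Longrightarrow> z powi m * z powi n = z powi (m + n)"
  for z :: complex
  by (subst power_int_add) auto

lemma borel_measurable_powi_circle [measurable]: "(\<lambda>z. z powi k) \<in> borel_measurable circle"
  by (rule continuous_borel_measurable_circle) (auto intro!: continuous_intros)

lemma integrable_circle_mult_bounded:
  fixes f g :: "complex \<Rightarrow> complex"
  assumes f: "integrable circle f" and g: "g \<in> borel_measurable circle"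
    and "AE z in circle. norm (g z) \<le> C"
  shows "integrable circle (\<lambda>z. f z * g z)"
proof (rule Bochner_Integration.integrable_bound)
  show "integrable circle (\<lambda>z. C * norm (f z))"
    using f by simp
  show "(\<lambda>z. f z * g z) \<in> borel_measurable circle"
    using f g by measurable
  show "AE z in circle. norm (f z * g z) \<le> norm (C * norm (f z))"
    using assms(3)
  proof eventually_elim
    case (elim z)
    then have "norm (f z) * norm (g z) \<le> norm (f z) * \<bar>C\<bar>"
      by (intro mult_left_mono) auto
    then show ?case by (simp add: norm_mult abs_mult mult.commute)
  qed
qed

lemma integrable_circle_powi:
  "integrable circle f \<Longrightarrow> integrable circle (\<lambda>z. f z * z powi k)"
  by (rule integrable_circle_mult_bounded[where C = 1])
     (auto intro!: AE_I2 simp: norm_power_int)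

lemma fourier_coeff_add:
  "integrable circle f \<Longrightarrow> integrable circle g \<Longrightarrow>
    fourier_coeff (\<lambda>z. f z + g z) k = fourier_coeff f k + fourier_coeff g k"
  by (simp add: fourier_coeff_def distrib_right integrable_circle_powi)

lemma fourier_coeff_diff:
  "integrable circle f \<Longrightarrow> integrable circle g \<Longrightarrow>
    fourier_coeff (\<lambda>z. f z - g z) k = fourier_coeff f k - fourier_coeff g k"
  by (simp add: fourier_coeff_def left_diff_distrib integrable_circle_powi)

lemma fourier_coeff_cmult: "fourier_coeff (\<lambda>z. c * f z) k = c * fourier_coeff f k"
  by (simp add: fourier_coeff_def mult.assoc)

lemma fourier_coeff_sum:
  "(\<And>i. i \<in> I \<Longrightarrow> integrable circle (f i)) \<Longrightarrow>
    fourier_coeff (\<lambda>z. \<Sum>i\<in>I. f i z) k = (\<Sum>i\<in>I. fourier_coeff (f i) k)"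
  by (simp add: fourier_coeff_def sum_distrib_right integrable_circle_powi)

lemma fourier_coeff_cong_AE:
  assumes "AE z in circle. f z = g z" "f \<in> borel_measurable circle" "g \<in> borel_measurable circle"
  shows "fourier_coeff f k = fourier_coeff g k"
  unfolding fourier_coeff_def using assms by (intro integral_cong_AE) auto

lemma fourier_coeff_mult_powi: "fourier_coeff (\<lambda>z. f z * z powi m) k = fourier_coeff f (k - m)"
  unfolding fourier_coeff_def
  by (rule Bochner_Integration.integral_cong)
     (simp_all add: powi_add_circle mult.assoc)

lemma fourier_coeff_powi: "fourier_coeff (\<lambda>z. z powi m) k = (if k = m then 1 else 0)"
proof -
  have "fourier_coeff (\<lambda>z. z powi m) k = (LINT z|circle. z powi (m - k))"
    unfolding fourier_coeff_def
    by (rule Bochner_Integration.integral_cong) (simp_all add: powi_add_circle)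
  then show ?thesis by (simp add: integral_circle_powi)
qed

text \<open>Quantifying over all \<open>f\<close> with vanishing coefficients makes the claim stable under products
  of polynomials, so no algebra of trigonometric polynomials is needed.\<close>

lemma fourier_coeff_mult_real_polynomial:
  assumes "real_polynomial_function p" "integrable circle f" "\<And>k. fourier_coeff f k = 0"
  shows "integrable circle (\<lambda>z. f z * of_real (p z)) \<and>
    (\<forall>k. fourier_coeff (\<lambda>z. f z * of_real (p z)) k = 0)"
  using assms
proof (induction arbitrary: f rule: real_polynomial_function.induct)
  case (linear p)
  interpret bounded_linear p by fact
  \<comment> \<open>A real linear functional of \<open>z\<close> is
    \<open>a * z + b * cnj z\<close>. On the circle \<open>cnj z\<close> is
    \<open>z powi (-1)\<close>, so multiplying by it only shifts coefficients by one in either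
    direction.\<close>
  define a where "a = (of_real (p 1) - \<i> * of_real (p \<i>)) / 2"
  define b where "b = (of_real (p 1) + \<i> * of_real (p \<i>)) / 2"
  have *: "f z * of_real (p z) = a * (f z * z powi 1) + b * (f z * z powi (-1))"
    if "z \<in> space circle" for z
  proof -
    have "p z = p (Re z *\<^sub>R 1 + Im z *\<^sub>R \<i>)"
      by (simp add: scaleR_conv_of_real complex_eq[symmetric] mult.commute)
    also have "\<dots> = Re z * p 1 + Im z * p \<i>"
      by (simp only: add scaleR real_scaleR_def)
    finally have "of_real (p z) = a * z + b * cnj z"
      by (auto simp: a_def b_def complex_eq_iff field_simps)
    moreover have "cnj z = z powi (-1)"
      using that by (simp add: cnj_eq_inverse_circle power_int_minus)
    ultimately show ?thesis by (simp add: algebra_simps)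
  qed
  have i: "integrable circle (\<lambda>z. a * (f z * z powi 1))" "integrable circle (\<lambda>z. b * (f z * z powi (-1)))"
    by (intro integrable_mult_right integrable_circle_powi linear.prems)+
  have "integrable circle (\<lambda>z. f z * of_real (p z)) =
      integrable circle (\<lambda>z. a * (f z * z powi 1) + b * (f z * z powi (-1)))"
    by (rule Bochner_Integration.integrable_cong) (use * in simp_all)
  moreover have "fourier_coeff (\<lambda>z. f z * of_real (p z)) k =
      fourier_coeff (\<lambda>z. a * (f z * z powi 1) + b * (f z * z powi (-1))) k" for k
    unfolding fourier_coeff_def
    by (rule Bochner_Integration.integral_cong) (use * in simp_all)
  ultimately show ?case
    using i linear.prems
    by (simp only: fourier_coeff_add fourier_coeff_cmult fourier_coeff_mult_powi) simp
next
  case (const c)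
  then show ?case
    using fourier_coeff_cmult[of "of_real c" f] by (simp add: mult.commute)
next
  case (add p q)
  then show ?case
    by (simp add: distrib_left fourier_coeff_add)
next
  case (mult p q)
  then show ?case
    using mult.IH(2)[of "\<lambda>z. f z * of_real (p z)"] mult.IH(1)[of f] by (simp add: mult.assoc)
qed

text \<open>Real polynomials approximate \<open>g\<close> uniformly on the compact circle and
  integrate to 0 against \<open>f\<close>; the error is at most \<open>e\<close> times the L1 norm
  of \<open>f\<close>, for every \<open>e > 0\<close>.\<close>

lemma integral_circle_mult_continuous:
  fixes g :: "complex \<Rightarrow> real"
  assumes f: "integrable circle f" "\<And>k. fourier_coeff f k = 0" and g: "continuous_on UNIV g"
  shows "(LINT z|circle. f z * of_real (g z)) = 0"
proof -
  have le: "norm (LINT z|circle. f z * of_real (g z)) \<le> e * (LINT z|circle. norm (f z))" if "e > 0" for e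
  proof -
    have "compact (sphere 0 1 :: complex set)" "continuous_on (sphere 0 1) g"
      using g by (auto intro: continuous_on_subset)
    from Stone_Weierstrass_real_polynomial_function[OF this \<open>e > 0\<close>]
    obtain p where p: "real_polynomial_function p" "\<And>z. z \<in> sphere 0 1 \<Longrightarrow> \<bar>g z - p z\<bar> < e"
      by blast
    have ip: "integrable circle (\<lambda>z. f z * of_real (p z))"
      and "fourier_coeff (\<lambda>z. f z * of_real (p z)) 0 = 0"
      using fourier_coeff_mult_real_polynomial[OF p(1) f] by auto
    then have p0: "(LINT z|circle. f z * of_real (p z)) = 0"
      by (simp add: fourier_coeff_def)
    have mg: "(\<lambda>z. complex_of_real (g z)) \<in> borel_measurable circle"
      using g by (intro continuous_borel_measurable_circle continuous_intros) (auto intro: continuous_on_subset)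
    have mp: "(\<lambda>z. complex_of_real (p z)) \<in> borel_measurable circle"
      using continuous_real_polymonial_function[OF p(1)]
      by (intro continuous_borel_measurable_circle continuous_intros)
         (auto simp: continuous_on_eq_continuous_within intro: continuous_at_imp_continuous_at_within)
    have id: "integrable circle (\<lambda>z. f z * (of_real (g z) - of_real (p z)))"
      by (rule integrable_circle_mult_bounded[where C = e])
         (use f mg mp p(2) norm_of_real[of "g _ - p _", where 'a = complex] in \<open>auto intro!: AE_I2 less_imp_le borel_measurable_diff\<close>)
    have "(LINT z|circle. f z * of_real (g z)) =
        (LINT z|circle. f z * (of_real (g z) - of_real (p z)) + f z * of_real (p z))"
      by (simp add: algebra_simps)
    also have "\<dots> = (LINT z|circle. f z * (of_real (g z) - of_real (p z)))"
      using id ip p0 by simp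
    also have "norm \<dots> \<le> (LINT z|circle. e * norm (f z))"
    proof (rule order_trans[OF integral_norm_bound], rule integral_mono)
      fix z :: complex assume "z \<in> space circle"
      then show "norm (f z * (of_real (g z) - of_real (p z))) \<le> e * norm (f z)"
        using less_imp_le[OF p(2)[of z]] mult_right_mono[of "\<bar>g z - p z\<bar>" e "norm (f z)"]
        by (simp add: norm_mult mult.commute flip: of_real_diff)
    qed (use id f in auto)
    finally show ?thesis by simp
  qed
  have "((\<lambda>e. e * (LINT z|circle. norm (f z))) \<longlongrightarrow> 0 * (LINT z|circle. norm (f z))) (at_right 0)"
    by (intro tendsto_intros)
  then have "norm (LINT z|circle. f z * of_real (g z)) \<le> 0 * (LINT z|circle. norm (f z))"
    by (rule tendsto_lowerbound)
       (auto intro: le eventually_mono[OF eventually_at_right_less[of 0]])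
  then show ?thesis by simp
qed

lemma integral_circle_indicator_closed:
  assumes f: "integrable circle f" "\<And>k. fourier_coeff f k = 0" and C: "closed C"
  shows "(LINT z|circle. f z * indicator C z) = 0"
proof (cases "C = {}")
  case False
  \<comment> \<open>These continuous functions are 1 on \<open>C\<close> and tend to 0 off it, with
    \<open>norm (f z)\<close> as a dominating function. The empty set is treated apart because
    \<open>infdist z {}\<close> is 0, which would make \<open>g n\<close> constantly 1.\<close>
  define g where "g n z = inverse (1 + real n * infdist z C)" for n z
  have cg: "continuous_on UNIV (g n)" for n
    unfolding g_def by (intro continuous_intros) (auto simp: add_nonneg_eq_0_iff infdist_nonneg)
  have mg: "(\<lambda>z. complex_of_real (g n z)) \<in> borel_measurable circle" for n
    using cg by (intro continuous_borel_measurable_circle continuous_intros) (auto intro: continuous_on_subset)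
  have "(\<lambda>n. LINT z|circle. f z * of_real (g n z)) \<longlonglongrightarrow> (LINT z|circle. f z * indicator C z)"
  proof (rule integral_dominated_convergence)
    show "integrable circle (\<lambda>z. norm (f z))" using f by simp
    show "(\<lambda>z. f z * of_real (g n z)) \<in> borel_measurable circle" for n
      using f mg by measurable
    show "(\<lambda>z. f z * indicator C z) \<in> borel_measurable circle"
      using f C by (intro borel_measurable_times borel_measurable_circleI[of "indicator C"]) auto
    show "AE z in circle. norm (f z * of_real (g n z)) \<le> norm (f z)" for n
    proof (rule AE_I2)
      fix z
      have "\<bar>g n z\<bar> \<le> 1"
        by (simp add: g_def infdist_nonneg inverse_le_1_iff)
      then show "norm (f z * of_real (g n z)) \<le> norm (f z)"
        using mult_left_mono[of "\<bar>g n z\<bar>" 1 "norm (f z)"] by (simp add: norm_mult)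
    qed
    show "AE z in circle. (\<lambda>n. f z * of_real (g n z)) \<longlonglongrightarrow> f z * indicator C z"
    proof (rule AE_I2)
      fix z
      have "(\<lambda>n. g n z) \<longlonglongrightarrow> indicator C z"
      proof (cases "z \<in> C")
        case True
        then show ?thesis by (simp add: g_def)
      next
        case z: False
        then have "infdist z C > 0"
          using C False infdist_nonneg[of z C] in_closed_iff_infdist_zero[of C z] by force
        then have "filterlim (\<lambda>n. 1 + real n * infdist z C) at_top sequentially"
          by (intro filterlim_tendsto_add_at_top[OF tendsto_const]
              filterlim_at_top_mult_tendsto_pos[OF tendsto_const] filterlim_real_sequentially)
        then show ?thesis
          using z by (simp add: g_def filterlim_inverse_at_top_iff tendsto_inverse_0_at_top)
      qed
      then have "(\<lambda>n. f z * of_real (g n z)) \<longlonglongrightarrow> f z * of_real (indicator C z)"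
        by (intro tendsto_intros)
      then show "(\<lambda>n. f z * of_real (g n z)) \<longlonglongrightarrow> f z * indicator C z"
        by (cases "z \<in> C") simp_all
    qed
  qed
  then have "(\<lambda>n. 0) \<longlonglongrightarrow> (LINT z|circle. f z * indicator C z)"
    by (simp add: integral_circle_mult_continuous[OF f cg])
  then show ?thesis by (simp add: LIMSEQ_const_iff)
qed simp

text \<open>The sets over which \<open>f\<close> integrates to 0 form a Dynkin system: the
  coefficient of index 0 handles complements, countable additivity disjoint unions. The closed sets
  are an intersection-stable generator.\<close>

lemma integral_circle_indicator_borel:
  assumes f: "integrable circle f" "\<And>k. fourier_coeff f k = 0" and A: "A \<in> sets borel"
  shows "(LINT z|circle. indicator A z *\<^sub>R f z) = 0"
proof -
  have ind_eq: "(\<lambda>z. f z * indicator A z) = (\<lambda>z. indicator A z *\<^sub>R f z)" for A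
    by (auto simp: indicator_def)
  have fA: "integrable circle (\<lambda>z. indicator A z *\<^sub>R f z)" if "A \<in> sets borel" for A
  proof -
    have "integrable circle (\<lambda>z. f z * indicator A z)"
      by (rule integrable_circle_mult_bounded[where C = 1])
         (use f that in \<open>auto intro!: borel_measurable_circleI AE_I2 simp: indicator_def\<close>)
    then show ?thesis by (simp only: ind_eq)
  qed
  have "Int_stable (Collect closed :: complex set set)" "Collect closed \<subseteq> Pow (UNIV :: complex set)"
    by (auto simp: Int_stable_def)
  moreover have "A \<in> sigma_sets UNIV (Collect closed)"
    using A by (simp add: borel_eq_closed)
  ultimately show ?thesis
  proof (induction rule: sigma_sets_induct_disjoint)
    case (basic A)
    then show ?case
      using integral_circle_indicator_closed[OF f, of A] by (simp add: ind_eq)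
  next
    case (compl A)
    have bA: "A \<in> sets borel" using compl by (simp add: borel_eq_closed)
    have "(LINT z|circle. indicator (UNIV - A) z *\<^sub>R f z) = (LINT z|circle. f z - indicator A z *\<^sub>R f z)"
      by (rule Bochner_Integration.integral_cong) (auto simp: indicator_def)
    also have "\<dots> = (LINT z|circle. f z)"
      using f fA[OF bA] compl by simp
    also have "\<dots> = fourier_coeff f 0"
      by (simp add: fourier_coeff_def)
    finally show ?case using f by simp
  next
    case (union A)
    have bA: "A i \<in> sets borel" for i using union by (auto simp: borel_eq_closed)
    \<comment> \<open>Borel sets of the plane are cut down to the circle, since countable additivity
      is stated for measurable sets of \<open>circle\<close>.\<close>
    have s: "A i \<inter> sphere 0 1 \<in> sets circle" for i
      using bA by (auto simp: sets_circle sets_restrict_space)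
    have eq: "(LINT z|circle. indicator B z *\<^sub>R f z) = (LINT z:(B \<inter> sphere 0 1)|circle. f z)" for B
      unfolding set_lebesgue_integral_def
      by (rule Bochner_Integration.integral_cong) (auto simp: indicator_def)
    have U: "(\<Union> (range A)) \<inter> sphere 0 1 = (\<Union>i. A i \<inter> sphere 0 1)" by auto
    have "integrable circle (\<lambda>z. indicator (\<Union>i. A i) z *\<^sub>R f z)"
      using bA by (intro fA) auto
    also have "?this \<longleftrightarrow> set_integrable circle (\<Union>i. A i \<inter> sphere 0 1) f"
      unfolding set_integrable_def
      by (rule Bochner_Integration.integrable_cong) (auto simp: indicator_def)
    finally have "(LINT z:(\<Union>i. A i \<inter> sphere 0 1)|circle. f z) = (\<Sum>i. LINT z:(A i \<inter> sphere 0 1)|circle. f z)"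
      using s union(1) by (intro lebesgue_integral_countable_add) (auto simp: disjoint_family_on_def)
    then show ?case
      using union(3) by (simp only: eq U) simp
  qed simp_all
qed

theorem fourier_coeff_eq_0_imp_AE_0:
  assumes f: "integrable circle f" "\<And>k. fourier_coeff f k = 0"
  shows "AE z in circle. f z = 0"
proof -
  have 0: "(LINT z:A|circle. f z) = 0" if "A \<in> sets circle" for A
  proof -
    have "A \<in> (\<inter>) (sphere 0 1) ` sets borel"
      using that by (simp add: sets_circle sets_restrict_space)
    then obtain B where B: "B \<in> sets borel" "A = sphere 0 1 \<inter> B"
      by (elim imageE)
    have "(LINT z:A|circle. f z) = (LINT z|circle. indicator B z *\<^sub>R f z)"
      unfolding set_lebesgue_integral_def B(2)
      by (rule Bochner_Integration.integral_cong) (auto simp: indicator_def)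
    then show ?thesis using integral_circle_indicator_borel[OF f B(1)] by simp
  qed
  have i: "integrable circle (\<lambda>z. indicator A z *\<^sub>R f z)" if "A \<in> sets circle" for A
    using integrable_mult_indicator[OF that f(1)] .
  \<comment> \<open>Uniqueness of densities, here against the density 0, is available for real
    functions; hence the two parts separately.\<close>
  have "AE z in circle. Re (f z) = 0"
  proof (rule density_unique_real)
    fix A assume A: "A \<in> sets circle"
    show "(LINT z:A|circle. Re (f z)) = (LINT z:A|circle. 0)"
      using integral_Re[OF i[OF A]] 0[OF A] by (simp add: set_lebesgue_integral_def)
  qed (use f in auto)
  moreover have "AE z in circle. Im (f z) = 0"
  proof (rule density_unique_real)
    fix A assume A: "A \<in> sets circle"
    show "(LINT z:A|circle. Im (f z)) = (LINT z:A|circle. 0)"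
      using integral_Im[OF i[OF A]] 0[OF A] by (simp add: set_lebesgue_integral_def)
  qed (use f in auto)
  ultimately show ?thesis
    by eventually_elim (simp add: complex_eq_iff)
qed

section \<open>The Riesz-Fischer and Parseval theorems\<close>

text \<open>Along a subsequence with squared distances at most \<open>4\<^sup>-\<^sup>j\<close>, the pointwise bound
  \<open>\<bar>d\<bar> \<le> 2\<^sup>-\<^sup>j + 2\<^sup>j \<bar>d\<bar>\<^sup>2\<close> for the increments makes the subsequence converge almost everywhere.\<close>

theorem riesz_fischer:
  fixes f :: "nat \<Rightarrow> 'a \<Rightarrow> 'b::{banach, second_countable_topology}"
  assumes m [measurable]: "\<And>n. f n \<in> borel_measurable M"
    and cauchy: "\<And>e. e > 0 \<Longrightarrow> \<exists>N. \<forall>m\<ge>N. \<forall>n\<ge>N. (\<integral>\<^sup>+x. (norm (f m x - f n x))\<^sup>2 \<partial>M) \<le> ennreal e"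
  obtains g where "g \<in> borel_measurable M" "(\<lambda>n. \<integral>\<^sup>+x. (norm (f n x - g x))\<^sup>2 \<partial>M) \<longlonglongrightarrow> 0"
proof -
  have "\<exists>N. \<forall>j. \<forall>m\<ge>N j. \<forall>n\<ge>N j. (\<integral>\<^sup>+x. (norm (f m x - f n x))\<^sup>2 \<partial>M) \<le> ennreal ((1/4) ^ j)"
    by (rule choice) (use cauchy in simp)
  then obtain N where N: "\<And>j m n. m \<ge> N j \<Longrightarrow> n \<ge> N j \<Longrightarrow>
      (\<integral>\<^sup>+x. (norm (f m x - f n x))\<^sup>2 \<partial>M) \<le> ennreal ((1/4) ^ j)"
    by blast
  \<comment> \<open>Summing the thresholds makes both \<open>r j\<close> and
    \<open>r (Suc j)\<close> at least \<open>N j\<close>; the added \<open>j\<close> makes the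
    subsequence unbounded.\<close>
  define r where "r j = (\<Sum>i\<le>j. N i) + j" for j
  have N_le: "N j \<le> (\<Sum>i\<le>j. N i)" for j
    by (rule member_le_sum) auto
  have r: "r j \<ge> N j" "r (Suc j) \<ge> N j" "r j \<ge> j" for j
    using N_le[of j] by (auto simp: r_def)
  define d where "d j x = f (r (Suc j)) x - f (r j) x" for j x
  have [measurable]: "d j \<in> borel_measurable M" for j
    unfolding d_def by measurable
  \<comment> \<open>The weight \<open>2 ^ j\<close> against squared distances of at most
    \<open>(1/4) ^ j\<close> still leaves a convergent geometric series.\<close>
  have "(\<integral>\<^sup>+x. (\<Sum>j. ennreal (2 ^ j * (norm (d j x))\<^sup>2)) \<partial>M) = (\<Sum>j. \<integral>\<^sup>+x. ennreal (2 ^ j * (norm (d j x))\<^sup>2) \<partial>M)"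
    by (rule nn_integral_suminf) measurable
  also have "\<dots> \<le> (\<Sum>j. ennreal ((1/2) ^ j))"
  proof (rule suminf_le)
    fix j
    have "(\<integral>\<^sup>+x. ennreal (2 ^ j * (norm (d j x))\<^sup>2) \<partial>M) = ennreal (2 ^ j) * (\<integral>\<^sup>+x. (norm (d j x))\<^sup>2 \<partial>M)"
      by (simp add: ennreal_mult nn_integral_cmult)
    also have "\<dots> \<le> ennreal (2 ^ j) * ennreal ((1/4) ^ j)"
      unfolding d_def by (intro mult_left_mono N r) simp
    also have "\<dots> = ennreal ((1/2) ^ j)"
      by (simp add: ennreal_mult[symmetric] power_mult_distrib[symmetric])
    finally show "(\<integral>\<^sup>+x. ennreal (2 ^ j * (norm (d j x))\<^sup>2) \<partial>M) \<le> ennreal ((1/2) ^ j)" .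
  qed simp_all
  also have "\<dots> = ennreal (\<Sum>j. (1/2) ^ j)"
    by (intro suminf_ennreal2) (auto intro!: summable_geometric)
  also have "\<dots> < \<infinity>" by simp
  finally have "(\<integral>\<^sup>+x. (\<Sum>j. ennreal (2 ^ j * (norm (d j x))\<^sup>2)) \<partial>M) \<noteq> \<infinity>" by simp
  then have "AE x in M. (\<Sum>j. ennreal (2 ^ j * (norm (d j x))\<^sup>2)) \<noteq> \<infinity>"
    by (intro nn_integral_PInf_AE) measurable
  then have conv: "AE x in M. convergent (\<lambda>j. f (r j) x)"
  proof eventually_elim
    case (elim x)
    then have s: "summable (\<lambda>j. 2 ^ j * (norm (d j x))\<^sup>2)"
      by (intro summable_suminf_not_top) auto
    have "summable (\<lambda>j. d j x)"
    proof (rule summable_comparison_test')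
      show "summable (\<lambda>j. (1/2) ^ j + 2 ^ j * (norm (d j x))\<^sup>2)"
        by (intro summable_add s) (simp add: summable_geometric)
      fix j
      \<comment> \<open>Expanding the square bounds \<open>2 ^ j * norm (d j x)\<close> by one plus
        its own square; dividing by \<open>2 ^ j\<close> gives the summable majorant.\<close>
      have "0 \<le> (1 - 2 ^ j * norm (d j x))\<^sup>2 + 2 ^ j * norm (d j x) + 2 ^ j * norm (d j x) - 2 ^ j * norm (d j x)"
        by (simp add: add_nonneg_nonneg)
      then have "2 ^ j * norm (d j x) \<le> 2 ^ j * ((1/2) ^ j + 2 ^ j * (norm (d j x))\<^sup>2)"
        by (simp add: power2_eq_square algebra_simps power_mult_distrib[symmetric])
      then show "norm (d j x) \<le> (1/2) ^ j + 2 ^ j * (norm (d j x))\<^sup>2"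
        by (simp only: mult_le_cancel_left_pos zero_less_power zero_less_numeral)
    qed
    then have "convergent (\<lambda>n. f (r 0) x + (\<Sum>j<n. d j x))"
      by (intro convergent_add convergent_const) (simp add: summable_iff_convergent)
    also have "(\<lambda>n. f (r 0) x + (\<Sum>j<n. d j x)) = (\<lambda>n. f (r n) x)"
    proof
      show "f (r 0) x + (\<Sum>j<n. d j x) = f (r n) x" for n
        using sum_lessThan_telescope[of "\<lambda>j. f (r j) x" n] by (simp add: d_def)
    qed
    finally show ?case .
  qed
  \<comment> \<open>Where the subsequence diverges \<open>lim\<close> is an unspecified value, which
    affects only a null set.\<close>
  define g where "g x = lim (\<lambda>j. f (r j) x)" for x
  have g [measurable]: "g \<in> borel_measurable M"
    unfolding g_def by measurable
  \<comment> \<open>Fatou's lemma along the subsequence passes the Cauchy bound to the limit, for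
    the whole sequence.\<close>
  have bound: "(\<integral>\<^sup>+x. (norm (f n x - g x))\<^sup>2 \<partial>M) \<le> ennreal e"
    if K: "\<And>m n. m \<ge> K \<Longrightarrow> n \<ge> K \<Longrightarrow> (\<integral>\<^sup>+x. (norm (f m x - f n x))\<^sup>2 \<partial>M) \<le> ennreal e" and "n \<ge> K"
    for n K e
  proof -
    have "(\<integral>\<^sup>+x. (norm (f n x - g x))\<^sup>2 \<partial>M) = (\<integral>\<^sup>+x. liminf (\<lambda>j. ennreal ((norm (f n x - f (r j) x))\<^sup>2)) \<partial>M)"
    proof (rule nn_integral_cong_AE)
      show "AE x in M. ennreal ((norm (f n x - g x))\<^sup>2) = liminf (\<lambda>j. ennreal ((norm (f n x - f (r j) x))\<^sup>2))"
        using conv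
      proof eventually_elim
        case (elim x)
        then have "(\<lambda>j. f (r j) x) \<longlonglongrightarrow> g x"
          by (simp add: g_def convergent_LIMSEQ_iff)
        then have "(\<lambda>j. ennreal ((norm (f n x - f (r j) x))\<^sup>2)) \<longlonglongrightarrow> ennreal ((norm (f n x - g x))\<^sup>2)"
          by (intro tendsto_intros)
        then show ?case
          by (intro lim_imp_Liminf[symmetric]) auto
      qed
    qed
    also have "\<dots> \<le> liminf (\<lambda>j. \<integral>\<^sup>+x. ennreal ((norm (f n x - f (r j) x))\<^sup>2) \<partial>M)"
      by (rule nn_integral_liminf) measurable
    also have "\<dots> \<le> ennreal e"
    proof (rule Liminf_le)
      show "\<forall>\<^sub>F j in sequentially. (\<integral>\<^sup>+x. ennreal ((norm (f n x - f (r j) x))\<^sup>2) \<partial>M) \<le> ennreal e"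
        using eventually_ge_at_top[of K]
        by eventually_elim (use r(3) \<open>n \<ge> K\<close> in \<open>auto intro: K order_trans\<close>)
    qed simp
    finally show ?thesis .
  qed
  have "(\<lambda>n. \<integral>\<^sup>+x. (norm (f n x - g x))\<^sup>2 \<partial>M) \<longlonglongrightarrow> 0"
  proof (rule tendsto_zero_ennreal)
    fix e :: real assume "e > 0"
    then obtain K where "\<forall>m\<ge>K. \<forall>n\<ge>K. (\<integral>\<^sup>+x. (norm (f m x - f n x))\<^sup>2 \<partial>M) \<le> ennreal (e / 2)"
      using cauchy[of "e / 2"] by auto
    then have "(\<integral>\<^sup>+x. (norm (f n x - g x))\<^sup>2 \<partial>M) \<le> ennreal (e / 2)" if "n \<ge> K" for n
      using bound that by blast
    moreover have "ennreal (e / 2) < ennreal e"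
      using \<open>e > 0\<close> by (simp add: ennreal_less_iff)
    ultimately show "\<forall>\<^sub>F n in sequentially. (\<integral>\<^sup>+x. (norm (f n x - g x))\<^sup>2 \<partial>M) < ennreal e"
      unfolding eventually_sequentially by (meson le_less_trans)
  qed
  with g show ?thesis by (rule that)
qed

section \<open>Closure properties of square-integrable and of bounded functions\<close>

lemma borel_measurable_cnj [measurable]: "cnj \<in> borel_measurable borel"
  by (intro borel_measurable_continuous_onI continuous_intros)

lemma Ltwo_measurable: "f \<in> Ltwo \<Longrightarrow> f \<in> borel_measurable circle"
  and Ltwo_integrable_sq: "f \<in> Ltwo \<Longrightarrow> integrable circle (\<lambda>z. (norm (f z))\<^sup>2)"
  by (simp_all add: Ltwo_def)

lemma integrable_Ltwo_mult:
  assumes "f \<in> Ltwo" "g \<in> Ltwo"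
  shows "integrable circle (\<lambda>z. f z * g z)"
proof (rule Bochner_Integration.integrable_bound)
  show "integrable circle (\<lambda>z. (norm (f z))\<^sup>2 + (norm (g z))\<^sup>2)"
    using assms by (simp add: Ltwo_def)
  show "(\<lambda>z. f z * g z) \<in> borel_measurable circle"
    using assms by (auto simp: Ltwo_def)
  have "norm (f z * g z) \<le> (norm (f z))\<^sup>2 + (norm (g z))\<^sup>2" for z
  proof -
    have "2 * (norm (f z) * norm (g z)) \<le> (norm (f z))\<^sup>2 + (norm (g z))\<^sup>2"
      using sum_squares_bound[of "norm (f z)" "norm (g z)"] by simp
    moreover have "0 \<le> norm (f z) * norm (g z)" by simp
    ultimately show ?thesis unfolding norm_mult by linarith
  qed
  then show "AE z in circle. norm (f z * g z) \<le> norm ((norm (f z))\<^sup>2 + (norm (g z))\<^sup>2)"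
    by (intro AE_I2) (simp add: order_trans[OF _ abs_ge_self])
qed

lemma Ltwo_cmult: "f \<in> Ltwo \<Longrightarrow> (\<lambda>z. c * f z) \<in> Ltwo"
  by (auto simp: Ltwo_def norm_mult power_mult_distrib)

lemma Ltwo_add:
  assumes "f \<in> Ltwo" "g \<in> Ltwo"
  shows "(\<lambda>z. f z + g z) \<in> Ltwo"
proof -
  have "integrable circle (\<lambda>z. (norm (f z + g z))\<^sup>2)"
  proof (rule Bochner_Integration.integrable_bound)
    show "integrable circle (\<lambda>z. 2 * (norm (f z))\<^sup>2 + 2 * (norm (g z))\<^sup>2)"
      using assms by (simp add: Ltwo_def)
    show "(\<lambda>z. (norm (f z + g z))\<^sup>2) \<in> borel_measurable circle"
      using assms by (auto simp: Ltwo_def)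
    have "(norm (f z + g z))\<^sup>2 \<le> 2 * (norm (f z))\<^sup>2 + 2 * (norm (g z))\<^sup>2" for z
    proof -
      have "(norm (f z + g z))\<^sup>2 \<le> (norm (f z) + norm (g z))\<^sup>2"
        by (intro power_mono norm_triangle_ineq) simp
      also have "\<dots> \<le> 2 * (norm (f z))\<^sup>2 + 2 * (norm (g z))\<^sup>2"
        using sum_squares_bound[of "norm (f z)" "norm (g z)"] by (simp add: power2_sum)
      finally show ?thesis .
    qed
    then show "AE z in circle. norm ((norm (f z + g z))\<^sup>2) \<le> norm (2 * (norm (f z))\<^sup>2 + 2 * (norm (g z))\<^sup>2)"
      by (intro AE_I2) (simp add: order_trans[OF _ abs_ge_self])
  qed
  with assms show ?thesis by (auto simp: Ltwo_def)
qed

lemma Ltwo_diff: "f \<in> Ltwo \<Longrightarrow> g \<in> Ltwo \<Longrightarrow> (\<lambda>z. f z - g z) \<in> Ltwo"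
  using Ltwo_add[of f "\<lambda>z. (-1) * g z"] Ltwo_cmult[of g "-1"] by simp

lemma Ltwo_powi: "(\<lambda>z. z powi k) \<in> Ltwo"
proof -
  have "integrable circle (\<lambda>z. (norm (z powi k))\<^sup>2) \<longleftrightarrow> integrable circle (\<lambda>z. 1 :: real)"
    by (rule Bochner_Integration.integrable_cong) (auto simp: norm_power_int)
  then show ?thesis by (simp add: Ltwo_def)
qed

lemma Ltwo_const: "(\<lambda>z. c) \<in> Ltwo"
  by (simp add: Ltwo_def)

lemma Ltwo_sum: "(\<And>i. i \<in> I \<Longrightarrow> f i \<in> Ltwo) \<Longrightarrow> (\<lambda>z. \<Sum>i\<in>I. f i z) \<in> Ltwo"
  by (induction I rule: infinite_finite_induct) (auto intro: Ltwo_add Ltwo_const)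

lemma Ltwo_cnj: "f \<in> Ltwo \<Longrightarrow> (\<lambda>z. cnj (f z)) \<in> Ltwo"
  by (auto simp: Ltwo_def)

lemma Ltwo_cnj_arg: "f \<in> Ltwo \<Longrightarrow> (\<lambda>z. f (cnj z)) \<in> Ltwo"
  using integrable_circle_cnj[of "\<lambda>z. (norm (f z))\<^sup>2"] measurable_compose[OF measurable_cnj_circle, of f borel]
  by (simp add: Ltwo_def)

lemma Linf_mult_Ltwo:
  assumes "F \<in> Linf" "f \<in> Ltwo"
  shows "(\<lambda>z. F z * f z) \<in> Ltwo"
proof -
  obtain C where m: "F \<in> borel_measurable circle" and C: "AE z in circle. norm (F z) \<le> C"
    using assms by (auto simp: Linf_def)
  have "integrable circle (\<lambda>z. (norm (F z * f z))\<^sup>2)"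
  proof (rule Bochner_Integration.integrable_bound)
    show "integrable circle (\<lambda>z. C\<^sup>2 * (norm (f z))\<^sup>2)"
      using assms by (simp add: Ltwo_def)
    show "(\<lambda>z. (norm (F z * f z))\<^sup>2) \<in> borel_measurable circle"
      using assms m by (auto simp: Ltwo_def)
    show "AE z in circle. norm ((norm (F z * f z))\<^sup>2) \<le> norm (C\<^sup>2 * (norm (f z))\<^sup>2)"
      using C
    proof eventually_elim
      case (elim z)
      then show ?case
        by (simp add: norm_mult power_mult_distrib mult_right_mono power_mono)
    qed
  qed
  with assms m show ?thesis by (auto simp: Ltwo_def)
qed

lemma Linf_Ltwo: "F \<in> Linf \<Longrightarrow> F \<in> Ltwo"
  using Linf_mult_Ltwo[of F "\<lambda>z. 1"] Ltwo_const by simp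

lemma Linf_mult:
  assumes "F \<in> Linf" "G \<in> Linf"
  shows "(\<lambda>z. F z * G z) \<in> Linf"
proof -
  obtain C D where m: "F \<in> borel_measurable circle" "G \<in> borel_measurable circle"
    and C: "AE z in circle. norm (F z) \<le> C" "AE z in circle. norm (G z) \<le> D"
    using assms by (auto simp: Linf_def)
  have "AE z in circle. norm (F z * G z) \<le> C * D"
    using C
  proof eventually_elim
    case (elim z)
    then show ?case
      unfolding norm_mult by (intro mult_mono) (auto intro: order_trans[OF norm_ge_zero])
  qed
  with m show ?thesis by (auto simp: Linf_def)
qed

lemma Linf_const: "(\<lambda>z. c) \<in> Linf"
  by (auto simp: Linf_def)

lemma Linf_add:
  assumes "F \<in> Linf" "G \<in> Linf"
  shows "(\<lambda>z. F z + G z) \<in> Linf"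
proof -
  obtain C D where m: "F \<in> borel_measurable circle" "G \<in> borel_measurable circle"
    and C: "AE z in circle. norm (F z) \<le> C" "AE z in circle. norm (G z) \<le> D"
    using assms by (auto simp: Linf_def)
  have "AE z in circle. norm (F z + G z) \<le> C + D"
    using C by eventually_elim (rule norm_triangle_le, simp)
  with m show ?thesis by (auto simp: Linf_def)
qed

lemma Linf_sum: "(\<And>i. i \<in> I \<Longrightarrow> f i \<in> Linf) \<Longrightarrow> (\<lambda>z. \<Sum>i\<in>I. f i z) \<in> Linf"
  by (induction I rule: infinite_finite_induct) (auto intro: Linf_add Linf_const)

lemma Linf_cnj: "f \<in> Linf \<Longrightarrow> (\<lambda>z. cnj (f z)) \<in> Linf"
  by (auto simp: Linf_def)

lemma Linf_cnj_arg:
  assumes "f \<in> Linf"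
  shows "(\<lambda>z. f (cnj z)) \<in> Linf"
proof -
  obtain C where m: "f \<in> borel_measurable circle" and C: "AE z in circle. norm (f z) \<le> C"
    using assms by (auto simp: Linf_def)
  have "AE z in distr circle circle cnj. norm (f z) \<le> C"
    unfolding distr_circle_cnj by (rule C)
  then have "AE z in circle. norm (f (cnj z)) \<le> C"
    using AE_distrD[OF measurable_cnj_circle] by blast
  with measurable_compose[OF measurable_cnj_circle m] show ?thesis
    by (auto simp: Linf_def)
qed

lemma Ltwo_integrable: "f \<in> Ltwo \<Longrightarrow> integrable circle f"
  using integrable_Ltwo_mult[of f "\<lambda>z. 1"] Ltwo_const by simp

lemma Ltwo_mult_powi: "f \<in> Ltwo \<Longrightarrow> (\<lambda>z. f z * z powi k) \<in> Ltwo"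
proof -
  have "AE z in circle. norm (z powi k) \<le> 1"
    by (rule AE_I2) (simp add: norm_power_int)
  then have "(\<lambda>z. z powi k) \<in> Linf"
    by (auto simp: Linf_def)
  then show "f \<in> Ltwo \<Longrightarrow> (\<lambda>z. f z * z powi k) \<in> Ltwo"
    using Linf_mult_Ltwo[of "\<lambda>z. z powi k" f] by (simp add: mult.commute)
qed

lemma Ltwo_AE_eqI:
  assumes "f \<in> Ltwo" "g \<in> Ltwo" "\<And>k. fourier_coeff f k = fourier_coeff g k"
  shows "AE z in circle. f z = g z"
proof -
  have "AE z in circle. f z - g z = 0"
    using assms by (intro fourier_coeff_eq_0_imp_AE_0) (auto simp: fourier_coeff_diff Ltwo_integrable)
  then show ?thesis by simp
qed

section \<open>Inner products, Bessel's inequality and Parseval's identity\<close>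

lemma integrable_Ltwo_inner:
  "f \<in> Ltwo \<Longrightarrow> g \<in> Ltwo \<Longrightarrow> integrable circle (\<lambda>z. f z * cnj (g z))"
  by (intro integrable_Ltwo_mult Ltwo_cnj)

lemma Ltwo_inner_diff_left:
  "f \<in> Ltwo \<Longrightarrow> g \<in> Ltwo \<Longrightarrow> h \<in> Ltwo \<Longrightarrow>
    Ltwo_inner (\<lambda>z. f z - g z) h = Ltwo_inner f h - Ltwo_inner g h"
  by (simp add: Ltwo_inner_def left_diff_distrib integrable_Ltwo_inner)

lemma Ltwo_inner_cmult_left: "Ltwo_inner (\<lambda>z. c * f z) h = c * Ltwo_inner f h"
  by (simp add: Ltwo_inner_def mult.assoc)

lemma Ltwo_inner_sum_left:
  "(\<And>i. i \<in> I \<Longrightarrow> f i \<in> Ltwo) \<Longrightarrow> h \<in> Ltwo \<Longrightarrow>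
    Ltwo_inner (\<lambda>z. \<Sum>i\<in>I. f i z) h = (\<Sum>i\<in>I. Ltwo_inner (f i) h)"
  by (simp add: Ltwo_inner_def sum_distrib_right integrable_Ltwo_inner)

lemma Ltwo_inner_commute: "Ltwo_inner g f = cnj (Ltwo_inner f g)"
  by (simp add: Ltwo_inner_def mult.commute flip: Bochner_Integration.integral_cnj)

lemma Ltwo_inner_self: "Ltwo_inner f f = of_real (LINT z|circle. (norm (f z))\<^sup>2)"
  by (simp add: Ltwo_inner_def complex_norm_square[symmetric] del: of_real_power)

lemma Ltwo_inner_cong_AE:
  assumes "AE z in circle. f z = g z" "f \<in> Ltwo" "g \<in> Ltwo" "h \<in> Ltwo"
  shows "Ltwo_inner f h = Ltwo_inner g h"
  unfolding Ltwo_inner_def using assms by (intro integral_cong_AE) (auto dest!: Ltwo_measurable)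

lemma Ltwo_inner_powi: "Ltwo_inner f (\<lambda>z. z powi k) = fourier_coeff f k"
  unfolding Ltwo_inner_def fourier_coeff_def
  by (rule Bochner_Integration.integral_cong)
     (simp_all add: cnj_eq_inverse_circle power_int_minus power_int_inverse)

text \<open>The frequencies are enumerated by a map \<open>\<iota>\<close> so that one development
  serves both halves of the spectrum, later with \<open>int\<close> and with
  \<open>neg_index\<close>.\<close>

lemma Ltwo_inner_trig_poly:
  "f \<in> Ltwo \<Longrightarrow> Ltwo_inner (\<lambda>z. \<Sum>i\<in>I. c i * z powi \<iota> i) f =
    (\<Sum>i\<in>I. c i * cnj (fourier_coeff f (\<iota> i)))"
  by (simp add: Ltwo_inner_sum_left Ltwo_cmult Ltwo_powi Ltwo_inner_cmult_left
      Ltwo_inner_commute[of "\<lambda>z. z powi \<iota> _" f] Ltwo_inner_powi)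

lemma fourier_coeff_trig_poly:
  assumes "finite I" "inj \<iota>"
  shows "fourier_coeff (\<lambda>z. \<Sum>i\<in>I. c i * z powi \<iota> i) (\<iota> j) = (if j \<in> I then c j else 0)"
proof -
  have "fourier_coeff (\<lambda>z. \<Sum>i\<in>I. c i * z powi \<iota> i) (\<iota> j) = (\<Sum>i\<in>I. c i * (if j = i then 1 else 0))"
    using assms(2)
    by (simp add: fourier_coeff_sum Ltwo_integrable Ltwo_cmult Ltwo_powi fourier_coeff_cmult
        fourier_coeff_powi inj_eq)
  also have "\<dots> = (\<Sum>i\<in>I. if j = i then c i else 0)"
    by (rule sum.cong) auto
  finally show ?thesis using assms(1) by simp
qed

lemma norm_sq_trig_poly:
  assumes "finite I" "inj \<iota>"
  shows "(LINT z|circle. (norm (\<Sum>i\<in>I. c i * z powi \<iota> i))\<^sup>2) = (\<Sum>i\<in>I. (norm (c i))\<^sup>2)"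
proof -
  have "complex_of_real (LINT z|circle. (norm (\<Sum>i\<in>I. c i * z powi \<iota> i))\<^sup>2) =
      (\<Sum>i\<in>I. c i * cnj (c i))"
    unfolding Ltwo_inner_self[symmetric]
    by (subst Ltwo_inner_trig_poly)
       (auto intro!: Ltwo_sum Ltwo_cmult Ltwo_powi simp: fourier_coeff_trig_poly assms)
  also have "\<dots> = complex_of_real (\<Sum>i\<in>I. (norm (c i))\<^sup>2)"
    by (simp add: complex_norm_square[symmetric] del: of_real_power)
  finally show ?thesis by (simp only: of_real_eq_iff)
qed

text \<open>For the partial Fourier sum \<open>S\<close>, orthonormality makes the inner products of
  \<open>S\<close> with \<open>f\<close> and with \<open>S\<close> equal, so the squared distance
  from \<open>f\<close> to \<open>S\<close> is the difference of the two sides.\<close>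

lemma bessel_inequality:
  assumes f: "f \<in> Ltwo" and \<iota>: "inj \<iota>" and I: "finite I"
  shows "(\<Sum>i\<in>I. (norm (fourier_coeff f (\<iota> i)))\<^sup>2) \<le> (LINT z|circle. (norm (f z))\<^sup>2)"
proof -
  define S where "S z = (\<Sum>i\<in>I. fourier_coeff f (\<iota> i) * z powi \<iota> i)" for z
  have S: "S \<in> Ltwo"
    unfolding S_def by (intro Ltwo_sum Ltwo_cmult Ltwo_powi)
  have Sf: "Ltwo_inner S f = of_real (\<Sum>i\<in>I. (norm (fourier_coeff f (\<iota> i)))\<^sup>2)"
    unfolding S_def using f by (simp add: Ltwo_inner_trig_poly complex_norm_square[symmetric] del: of_real_power)
  have SS: "Ltwo_inner S S = of_real (\<Sum>i\<in>I. (norm (fourier_coeff f (\<iota> i)))\<^sup>2)"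
    unfolding S_def Ltwo_inner_self norm_sq_trig_poly[OF I \<iota>] ..
  have "complex_of_real (LINT z|circle. (norm (f z - S z))\<^sup>2) = Ltwo_inner (\<lambda>z. f z - S z) (\<lambda>z. f z - S z)"
    by (simp add: Ltwo_inner_self)
  also have "\<dots> = Ltwo_inner f (\<lambda>z. f z - S z) - Ltwo_inner S (\<lambda>z. f z - S z)"
    using f S by (intro Ltwo_inner_diff_left Ltwo_diff)
  also have "\<dots> = cnj (Ltwo_inner f f - Ltwo_inner S f) - cnj (Ltwo_inner f S - Ltwo_inner S S)"
    using f S by (simp add: Ltwo_inner_commute[of f "\<lambda>z. f z - S z"]
        Ltwo_inner_commute[of S "\<lambda>z. f z - S z"] Ltwo_inner_diff_left)
  also have "\<dots> = of_real ((LINT z|circle. (norm (f z))\<^sup>2) - (\<Sum>i\<in>I. (norm (fourier_coeff f (\<iota> i)))\<^sup>2))"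
    by (simp add: Sf SS Ltwo_inner_commute[of f S] Ltwo_inner_self[of f])
  finally have "(LINT z|circle. (norm (f z - S z))\<^sup>2) =
      (LINT z|circle. (norm (f z))\<^sup>2) - (\<Sum>i\<in>I. (norm (fourier_coeff f (\<iota> i)))\<^sup>2)"
    by (simp only: of_real_eq_iff)
  moreover have "0 \<le> (LINT z|circle. (norm (f z - S z))\<^sup>2)" by simp
  ultimately show ?thesis by simp
qed

lemma summable_fourier_coeff_sq:
  assumes "f \<in> Ltwo" "inj \<iota>"
  shows "summable (\<lambda>m::nat. (norm (fourier_coeff f (\<iota> m)))\<^sup>2)"
  using bessel_inequality[OF assms] by (intro summableI_nonneg_bounded) auto

text \<open>The bound on the inner product is AM-GM with weight \<open>t\<close>; taking \<open>t\<close> small makes the second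
  summand small and the first then tends to 0.\<close>

lemma Ltwo_inner_bound:
  assumes f: "f \<in> Ltwo" and g: "g \<in> Ltwo" and t: "t > 0"
  shows "norm (Ltwo_inner f g) \<le>
    (LINT z|circle. (norm (f z))\<^sup>2) / t + t * (LINT z|circle. (norm (g z))\<^sup>2)"
proof -
  have "norm (Ltwo_inner f g) \<le> (LINT z|circle. norm (f z * cnj (g z)))"
    unfolding Ltwo_inner_def by (rule integral_norm_bound)
  also have "\<dots> \<le> (LINT z|circle. (norm (f z))\<^sup>2 / t + t * (norm (g z))\<^sup>2)"
  proof (rule integral_mono)
    fix z
    have "2 * (t * norm (g z)) * norm (f z) \<le> (t * norm (g z))\<^sup>2 + (norm (f z))\<^sup>2"
      by (rule sum_squares_bound)
    moreover have "0 \<le> t * norm (g z) * norm (f z)" using t by simp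
    ultimately have "t * norm (g z) * norm (f z) \<le> (t * norm (g z))\<^sup>2 + (norm (f z))\<^sup>2"
      by linarith
    then have "t * norm (g z) * norm (f z) / t \<le> ((t * norm (g z))\<^sup>2 + (norm (f z))\<^sup>2) / t"
      using t by (intro divide_right_mono) auto
    then show "norm (f z * cnj (g z)) \<le> (norm (f z))\<^sup>2 / t + t * (norm (g z))\<^sup>2"
      using t by (simp add: norm_mult add_divide_distrib power2_eq_square mult_ac)
  qed (use f g integrable_norm[OF integrable_Ltwo_inner[OF f g]] in \<open>auto simp: Ltwo_def\<close>)
  also have "\<dots> = (LINT z|circle. (norm (f z))\<^sup>2) / t + t * (LINT z|circle. (norm (g z))\<^sup>2)"
    using f g by (simp add: Ltwo_def)
  finally show ?thesis .
qed

lemma Ltwo_inner_tendsto: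
  assumes f: "\<And>n. f n \<in> Ltwo" and g: "g \<in> Ltwo" and h: "h \<in> Ltwo"
    and lim: "(\<lambda>n. LINT z|circle. (norm (f n z - g z))\<^sup>2) \<longlonglongrightarrow> 0"
  shows "(\<lambda>n. Ltwo_inner (f n) h) \<longlonglongrightarrow> Ltwo_inner g h"
proof (rule Lim_null[THEN iffD2], rule tendsto_norm_zero_cancel, rule order_tendstoI)
  fix e :: real assume "e > 0"
  define B where "B = (LINT z|circle. (norm (h z))\<^sup>2)"
  have B: "B \<ge> 0" by (simp add: B_def)
  \<comment> \<open>The second summand is then at most \<open>e / 2\<close>; the 1 keeps the
    denominator positive when \<open>h\<close> is null.\<close>
  define t where "t = e / (2 * (B + 1))"
  have t: "t > 0" "t * B \<le> e / 2"
    using B \<open>e > 0\<close> by (auto simp: t_def field_simps)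
  have "e / 2 * t > 0" using t \<open>e > 0\<close> by simp
  with lim have "\<forall>\<^sub>F n in sequentially. (LINT z|circle. (norm (f n z - g z))\<^sup>2) < e / 2 * t"
    by (rule order_tendstoD(2))
  then show "\<forall>\<^sub>F n in sequentially. norm (Ltwo_inner (f n) h - Ltwo_inner g h) < e"
  proof eventually_elim
    case (elim n)
    have "norm (Ltwo_inner (f n) h - Ltwo_inner g h) \<le>
        (LINT z|circle. (norm (f n z - g z))\<^sup>2) / t + t * B"
      using Ltwo_inner_bound[OF Ltwo_diff[OF f g] h t(1), of n]
      by (simp add: Ltwo_inner_diff_left[OF f g h] B_def)
    also have "(LINT z|circle. (norm (f n z - g z))\<^sup>2) / t < e / 2"
      using elim t by (simp add: pos_divide_less_eq)
    finally show ?case using t(2) by linarith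
  qed
qed (auto intro!: always_eventually intro: less_le_trans[OF _ norm_ge_zero])

text \<open>By orthonormality the squared distance of two partial sums is a block of the summable
  series, so the partial sums converge in L2; pairing them with \<open>h\<close> gives the stated
  series.\<close>

lemma Ltwo_of_sq_summable:
  fixes \<iota> :: "nat \<Rightarrow> int"
  assumes \<iota>: "inj \<iota>" and c: "summable (\<lambda>m. (norm (c m))\<^sup>2)"
  obtains g where "g \<in> Ltwo" "\<And>h. h \<in> Ltwo \<Longrightarrow> (\<lambda>m. c m * cnj (fourier_coeff h (\<iota> m))) sums Ltwo_inner g h"
proof -
  define S where "S n z = (\<Sum>m<n. c m * z powi \<iota> m)" for n z
  have S: "S n \<in> Ltwo" for n
    unfolding S_def by (intro Ltwo_sum Ltwo_cmult Ltwo_powi)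
  have dist: "(\<integral>\<^sup>+z. (norm (S m z - S n z))\<^sup>2 \<partial>circle) = ennreal (\<Sum>i\<in>{m..<n}. (norm (c i))\<^sup>2)"
    if "m \<le> n" for m n
  proof -
    have eq: "S n z - S m z = (\<Sum>i\<in>{m..<n}. c i * z powi \<iota> i)" for z
      using sum_diff_nat_ivl[of 0 m n "\<lambda>i. c i * z powi \<iota> i"] that
      by (simp add: S_def lessThan_atLeast0)
    have "(\<integral>\<^sup>+z. (norm (S m z - S n z))\<^sup>2 \<partial>circle) = ennreal (LINT z|circle. (norm (S n z - S m z))\<^sup>2)"
      unfolding norm_minus_commute[of "S m _"]
      by (rule nn_integral_eq_integral) (auto intro: Ltwo_integrable_sq[OF Ltwo_diff[OF S S]])
    also have "\<dots> = ennreal (\<Sum>i\<in>{m..<n}. (norm (c i))\<^sup>2)"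
      unfolding eq by (simp add: norm_sq_trig_poly \<iota>)
    finally show ?thesis .
  qed
  obtain g where g: "g \<in> borel_measurable circle"
      "(\<lambda>n. \<integral>\<^sup>+z. (norm (S n z - g z))\<^sup>2 \<partial>circle) \<longlonglongrightarrow> 0"
  proof (rule riesz_fischer)
    show "S n \<in> borel_measurable circle" for n
      by (rule Ltwo_measurable[OF S])
    fix e :: real assume "e > 0"
    then obtain N where N: "\<And>m n. m \<ge> N \<Longrightarrow> norm (\<Sum>i\<in>{m..<n}. (norm (c i))\<^sup>2) < e"
      using c unfolding summable_Cauchy by blast
    have le: "(\<integral>\<^sup>+z. (norm (S m z - S n z))\<^sup>2 \<partial>circle) \<le> ennreal e" if "m \<ge> N" "m \<le> n" for m n
      using N[OF that(1), of n] by (subst dist[OF that(2)]) (auto intro: ennreal_leI)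
    have "(\<integral>\<^sup>+z. (norm (S m z - S n z))\<^sup>2 \<partial>circle) \<le> ennreal e" if "m \<ge> N" "n \<ge> N" for m n
      using le[of m n] le[of n m] that by (cases "m \<le> n") (auto simp: norm_minus_commute)
    then show "\<exists>N. \<forall>m\<ge>N. \<forall>n\<ge>N. (\<integral>\<^sup>+z. (norm (S m z - S n z))\<^sup>2 \<partial>circle) \<le> ennreal e"
      by blast
  qed
  \<comment> \<open>The limit is so far only measurable. Some partial sum lies at finite distance
    from it, and subtracting that L2 difference from the partial sum puts \<open>g\<close> into
    L2.\<close>
  have fin: "\<forall>\<^sub>F n in sequentially. (\<integral>\<^sup>+z. (norm (S n z - g z))\<^sup>2 \<partial>circle) < 1"
    using g(2) by (rule order_tendstoD(2)) simp
  then obtain n0 where n0: "(\<integral>\<^sup>+z. (norm (S n0 z - g z))\<^sup>2 \<partial>circle) < 1"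
    by (auto simp: eventually_sequentially)
  have "(\<lambda>z. S n0 z - g z) \<in> Ltwo"
    unfolding Ltwo_def using n0 g(1) Ltwo_measurable[OF S, of n0]
    by (auto intro!: integrableI_nonneg intro: less_trans[OF _ ennreal_one_less_top])
  from Ltwo_diff[OF S[of n0] this] have gL: "g \<in> Ltwo" by simp
  have "(\<lambda>n. enn2real (\<integral>\<^sup>+z. (norm (S n z - g z))\<^sup>2 \<partial>circle)) \<longlonglongrightarrow> 0"
    using tendsto_enn2real[OF g(2)[folded ennreal_0]] by simp
  also have "(\<lambda>n. enn2real (\<integral>\<^sup>+z. (norm (S n z - g z))\<^sup>2 \<partial>circle)) = (\<lambda>n. LINT z|circle. (norm (S n z - g z))\<^sup>2)"
    using Ltwo_measurable[OF S] g(1) by (intro ext integral_eq_nn_integral[symmetric]) auto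
  finally have lim: "(\<lambda>n. LINT z|circle. (norm (S n z - g z))\<^sup>2) \<longlonglongrightarrow> 0" .
  have "(\<lambda>m. c m * cnj (fourier_coeff h (\<iota> m))) sums Ltwo_inner g h" if "h \<in> Ltwo" for h
  proof -
    have "(\<lambda>n. Ltwo_inner (S n) h) \<longlonglongrightarrow> Ltwo_inner g h"
      by (rule Ltwo_inner_tendsto[OF S gL that lim])
    then show ?thesis
      unfolding sums_def S_def using that by (simp add: Ltwo_inner_trig_poly)
  qed
  with gL show ?thesis by (rule that)
qed

lemma Ltwo_of_sq_summable_coeff:
  fixes \<iota> :: "nat \<Rightarrow> int"
  assumes \<iota>: "inj \<iota>" and c: "summable (\<lambda>m. (norm (c m))\<^sup>2)"
  obtains g where "g \<in> Ltwo" "\<And>h. h \<in> Ltwo \<Longrightarrow> (\<lambda>m. c m * cnj (fourier_coeff h (\<iota> m))) sums Ltwo_inner g h"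
    "\<And>m. fourier_coeff g (\<iota> m) = c m" "\<And>k. k \<notin> range \<iota> \<Longrightarrow> fourier_coeff g k = 0"
proof -
  obtain g where g: "g \<in> Ltwo"
    and s: "\<And>h. h \<in> Ltwo \<Longrightarrow> (\<lambda>m. c m * cnj (fourier_coeff h (\<iota> m))) sums Ltwo_inner g h"
    using Ltwo_of_sq_summable[OF assms] by blast
  \<comment> \<open>Pairing \<open>g\<close> with a monomial extracts its coefficient; injectivity
    of \<open>\<iota>\<close> leaves at most one nonzero term.\<close>
  have k: "(\<lambda>m. c m * (if \<iota> m = k then 1 else 0)) sums fourier_coeff g k" for k
    using s[OF Ltwo_powi[of k]] by (simp add: Ltwo_inner_powi fourier_coeff_powi if_distrib cong: if_cong)
  have "fourier_coeff g (\<iota> m) = c m" for m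
  proof -
    have "(\<lambda>i. c i * (if \<iota> i = \<iota> m then 1 else 0)) = (\<lambda>i. if i = m then c i else 0)"
      using \<iota> by (auto simp: inj_eq)
    with k[of "\<iota> m"] have "(\<lambda>i. if i = m then c i else 0) sums fourier_coeff g (\<iota> m)" by simp
    then show ?thesis using sums_unique2 sums_single by blast
  qed
  moreover have "fourier_coeff g k = 0" if "k \<notin> range \<iota>" for k
  proof -
    have "(\<lambda>i. c i * (if \<iota> i = k then 1 else 0)) = (\<lambda>i. 0)"
      using that by (intro ext) (use rangeI[of \<iota>] in auto)
    with k[of k] have "(\<lambda>i::nat. 0) sums fourier_coeff g k" by simp
    then show ?thesis using sums_unique2 sums_zero by blast
  qed
  ultimately show ?thesis using g s by (intro that)
qed

text \<open>The function rebuilt from the coefficients of \<open>f\<close> satisfies the series by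
  construction. It has the same coefficients as \<open>f\<close> at every integer, hence equals
  \<open>f\<close> almost everywhere.\<close>

theorem parseval_spectrum:
  fixes \<iota> :: "nat \<Rightarrow> int"
  assumes "inj \<iota>" "f \<in> Ltwo" "h \<in> Ltwo" "\<And>k. k \<notin> range \<iota> \<Longrightarrow> fourier_coeff f k = 0"
  shows "(\<lambda>m. fourier_coeff f (\<iota> m) * cnj (fourier_coeff h (\<iota> m))) sums Ltwo_inner f h"
proof -
  from Ltwo_of_sq_summable_coeff[OF assms(1) summable_fourier_coeff_sq[OF assms(2,1)]]
  obtain g where g: "g \<in> Ltwo"
    "\<And>h. h \<in> Ltwo \<Longrightarrow> (\<lambda>m. fourier_coeff f (\<iota> m) * cnj (fourier_coeff h (\<iota> m))) sums Ltwo_inner g h"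
    "\<And>m. fourier_coeff g (\<iota> m) = fourier_coeff f (\<iota> m)" "\<And>k. k \<notin> range \<iota> \<Longrightarrow> fourier_coeff g k = 0"
    by metis
  have "fourier_coeff g k = fourier_coeff f k" for k
    using g(3,4) assms(4) by (cases "k \<in> range \<iota>") auto
  then have "AE z in circle. g z = f z"
    by (intro Ltwo_AE_eqI g assms) auto
  then have "Ltwo_inner g h = Ltwo_inner f h"
    using g assms by (intro Ltwo_inner_cong_AE)
  with g(2)[OF assms(3)] show ?thesis by simp
qed

section \<open>The projection onto the Hardy space\<close>

lemma range_int_nat: "k \<in> range int \<longleftrightarrow> k \<ge> 0"
  by (metis imageE nonneg_int_cases of_nat_0_le_iff rangeI)

text \<open>Enumerates the negative integers from -1 downwards. The offset matches the factor
  \<open>cnj z\<close> in \<open>hankel\<close>, under which index \<open>k\<close> reads index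
  \<open>- k - 1\<close>.\<close>

definition neg_index :: "nat \<Rightarrow> int" where
  "neg_index m = - int m - 1"

lemma inj_neg_index: "inj neg_index"
  by (auto simp: inj_def neg_index_def)

lemma range_neg_index: "k \<in> range neg_index \<longleftrightarrow> k < 0"
proof
  assume "k < 0"
  then have "k = neg_index (nat (- k - 1))" by (simp add: neg_index_def)
  then show "k \<in> range neg_index" by blast
qed (auto simp: neg_index_def)

lemma Htwo_Ltwo: "f \<in> Htwo \<Longrightarrow> f \<in> Ltwo"
  and fourier_coeff_Htwo: "f \<in> Htwo \<Longrightarrow> k < 0 \<Longrightarrow> fourier_coeff f k = 0"
  by (simp_all add: Htwo_def)

lemma Htwo_AE_eqI:
  assumes "f \<in> Htwo" "g \<in> Htwo" "\<And>k. k \<ge> 0 \<Longrightarrow> fourier_coeff f k = fourier_coeff g k"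
  shows "AE z in circle. f z = g z"
proof (rule Ltwo_AE_eqI)
  show "fourier_coeff f k = fourier_coeff g k" for k
    using assms by (cases "k < 0") (auto simp: fourier_coeff_Htwo)
qed (use assms Htwo_Ltwo in auto)

lemma Htwo_powi: "k \<ge> 0 \<Longrightarrow> (\<lambda>z. z powi k) \<in> Htwo"
  by (simp add: Htwo_def Ltwo_powi fourier_coeff_powi)

lemma Htwo_zero: "(\<lambda>z. 0) \<in> Htwo"
  by (simp add: Htwo_def Ltwo_const fourier_coeff_def)

text \<open>Square summability of the nonnegative coefficients of \<open>f\<close> yields a
  candidate \<open>g\<close>. Then \<open>f - g\<close> has only negative and \<open>h\<close> only
  nonnegative frequencies, so every term of the Parseval series vanishes and the \<open>SOME\<close>
  in \<open>hardy_proj\<close> has a witness.\<close>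

lemma
  assumes f: "f \<in> Ltwo"
  shows hardy_proj_Htwo: "hardy_proj f \<in> Htwo"
    and Ltwo_inner_hardy_proj: "h \<in> Htwo \<Longrightarrow> Ltwo_inner (hardy_proj f) h = Ltwo_inner f h"
proof -
  from Ltwo_of_sq_summable_coeff[OF inj_of_nat summable_fourier_coeff_sq[OF f inj_of_nat]]
  obtain g where g: "g \<in> Ltwo"
    "\<And>m. fourier_coeff g (int m) = fourier_coeff f (int m)" "\<And>k. k \<notin> range int \<Longrightarrow> fourier_coeff g k = 0"
    by metis
  have gH: "g \<in> Htwo"
    using g by (auto simp: Htwo_def range_int_nat)
  have fg: "fourier_coeff f k = fourier_coeff g k" if "k \<ge> 0" for k
    using g(2)[of "nat k"] that by simp
  have ort: "Ltwo_inner (\<lambda>z. f z - g z) h = 0" if "h \<in> Htwo" for h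
  proof -
    have "(\<lambda>m. fourier_coeff (\<lambda>z. f z - g z) (neg_index m) * cnj (fourier_coeff h (neg_index m)))
        sums Ltwo_inner (\<lambda>z. f z - g z) h"
      using f g(1) that
      by (intro parseval_spectrum inj_neg_index)
         (auto intro: Ltwo_diff Htwo_Ltwo simp: range_neg_index fourier_coeff_diff Ltwo_integrable fg)
    moreover have "fourier_coeff h (neg_index m) = 0" for m
      using that by (simp add: fourier_coeff_Htwo neg_index_def)
    ultimately have "(\<lambda>m::nat. 0) sums Ltwo_inner (\<lambda>z. f z - g z) h" by simp
    then show ?thesis using sums_unique2 sums_zero by blast
  qed
  have P: "hardy_proj f \<in> Htwo \<and> (\<forall>h\<in>Htwo. Ltwo_inner (\<lambda>z. f z - hardy_proj f z) h = 0)"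
    unfolding hardy_proj_def by (rule someI[of _ g]) (use gH ort in blast)
  then show H: "hardy_proj f \<in> Htwo" by blast
  show "Ltwo_inner (hardy_proj f) h = Ltwo_inner f h" if "h \<in> Htwo"
    using P that f H by (simp add: Ltwo_inner_diff_left Htwo_Ltwo)
qed

lemma fourier_coeff_hardy_proj:
  "f \<in> Ltwo \<Longrightarrow> fourier_coeff (hardy_proj f) k = (if k \<ge> 0 then fourier_coeff f k else 0)"
  using Ltwo_inner_hardy_proj[of f "\<lambda>z. z powi k"] hardy_proj_Htwo[of f]
  by (simp add: Htwo_powi Ltwo_inner_powi fourier_coeff_Htwo)

lemma fourier_coeff_cnj: "fourier_coeff (\<lambda>z. cnj (f z)) k = cnj (fourier_coeff f (- k))"
  unfolding fourier_coeff_def Bochner_Integration.integral_cnj[symmetric]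
  by (rule Bochner_Integration.integral_cong)
     (simp_all add: cnj_eq_inverse_circle power_int_inverse power_int_minus)

lemma fourier_coeff_mult_inner:
  "fourier_coeff (\<lambda>z. F z * f z) n = Ltwo_inner f (\<lambda>z. cnj (F z) * z powi n)"
  unfolding fourier_coeff_def Ltwo_inner_def
  by (rule Bochner_Integration.integral_cong)
     (simp_all add: cnj_eq_inverse_circle power_int_inverse power_int_minus)

text \<open>The convolution formula, read off from Parseval by pairing \<open>f\<close> with the
  conjugate of \<open>F\<close> times a monomial. Only the spectrum of \<open>f\<close> is
  enumerated; that of \<open>F\<close> may be two-sided.\<close>

lemma fourier_coeff_mult_spectrum:
  fixes \<iota> :: "nat \<Rightarrow> int"
  assumes "inj \<iota>" "f \<in> Ltwo" "F \<in> Linf" "\<And>k. k \<notin> range \<iota> \<Longrightarrow> fourier_coeff f k = 0"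
  shows "(\<lambda>m. fourier_coeff F (n - \<iota> m) * fourier_coeff f (\<iota> m)) sums fourier_coeff (\<lambda>z. F z * f z) n"
proof -
  have "(\<lambda>z. cnj (F z) * z powi n) \<in> Ltwo"
    using assms by (intro Ltwo_mult_powi Ltwo_cnj Linf_Ltwo)
  from parseval_spectrum[OF assms(1,2) this assms(4)]
  have "(\<lambda>m. fourier_coeff f (\<iota> m) * fourier_coeff F (n - \<iota> m)) sums
      Ltwo_inner f (\<lambda>z. cnj (F z) * z powi n)"
    by (simp add: fourier_coeff_mult_powi fourier_coeff_cnj)
  then show ?thesis
    unfolding fourier_coeff_mult_inner by (simp add: mult.commute)
qed

lemma fourier_coeff_cnj_arg:
  assumes "f \<in> borel_measurable circle"
  shows "fourier_coeff (\<lambda>z. f (cnj z)) k = fourier_coeff f (- k)"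
proof -
  have "fourier_coeff (\<lambda>z. f (cnj z)) k = (LINT z|circle. (f (cnj z) * cnj z powi k))"
    unfolding fourier_coeff_def
    by (rule Bochner_Integration.integral_cong)
       (simp_all add: cnj_eq_inverse_circle power_int_inverse power_int_minus)
  also have "\<dots> = (LINT z|circle. f z * z powi k)"
    by (intro assms integral_circle_cnj[of "\<lambda>z. f z * z powi k"] borel_measurable_times borel_measurable_powi_circle)
  finally show ?thesis by (simp add: fourier_coeff_def)
qed

lemma fourier_coeff_flip:
  assumes "f \<in> Ltwo"
  shows "fourier_coeff (\<lambda>z. cnj z * f (cnj z)) k = fourier_coeff f (- k - 1)"
proof -
  have "fourier_coeff (\<lambda>z. cnj z * f (cnj z)) k = fourier_coeff (\<lambda>z. z * f z) (- k)"
    by (rule fourier_coeff_cnj_arg) (use Ltwo_measurable[OF assms] in \<open>intro borel_measurable_times borel_measurable_circleI[of "\<lambda>z. z"], simp_all\<close>)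
  also have "\<dots> = fourier_coeff f (- k - 1)"
    using fourier_coeff_mult_powi[of f 1] by (simp add: mult.commute)
  finally show ?thesis .
qed

lemma Ltwo_flip: "f \<in> Ltwo \<Longrightarrow> (\<lambda>z. cnj z * f (cnj z)) \<in> Ltwo"
  using Ltwo_cnj_arg[OF Ltwo_mult_powi[of f 1]] by (simp add: mult.commute)

section \<open>Toeplitz and Hankel operators\<close>

definition vec_coeff :: "(complex \<Rightarrow> complex ^ 'n) \<Rightarrow> int \<Rightarrow> complex ^ 'n" where
  "vec_coeff f k = (\<chi> i. fourier_coeff (\<lambda>z. f z $ i) k)"

definition mat_coeff :: "(complex \<Rightarrow> complex ^ 'n ^ 'm) \<Rightarrow> int \<Rightarrow> complex ^ 'n ^ 'm" where
  "mat_coeff F k = (\<chi> i j. fourier_coeff (\<lambda>z. F z $ i $ j) k)"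

definition Ltwo_vec :: "(complex \<Rightarrow> complex ^ 'n) set" where
  "Ltwo_vec = {f. \<forall>i. (\<lambda>z. f z $ i) \<in> Ltwo}"

lemma Htwo_vec_Ltwo_vec: "f \<in> Htwo_vec \<Longrightarrow> f \<in> Ltwo_vec"
  by (simp add: Htwo_vec_def Ltwo_vec_def Htwo_Ltwo)

lemma vec_coeff_Htwo_vec: "f \<in> Htwo_vec \<Longrightarrow> k < 0 \<Longrightarrow> vec_coeff f k = 0"
  by (simp add: Htwo_vec_def vec_coeff_def vec_eq_iff fourier_coeff_Htwo)

lemma Linf_mat_mult_vec: "F \<in> Linf_mat \<Longrightarrow> f \<in> Ltwo_vec \<Longrightarrow> (\<lambda>z. F z *v f z) \<in> Ltwo_vec"
  by (auto simp: Linf_mat_def Ltwo_vec_def matrix_vector_mult_def intro!: Ltwo_sum Linf_mult_Ltwo)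

lemma Linf_mat_mult: "F \<in> Linf_mat \<Longrightarrow> G \<in> Linf_mat \<Longrightarrow> (\<lambda>z. F z ** G z) \<in> Linf_mat"
  by (auto simp: Linf_mat_def matrix_matrix_mult_def intro!: Linf_sum Linf_mult)

lemma Linf_mat_add: "F \<in> Linf_mat \<Longrightarrow> G \<in> Linf_mat \<Longrightarrow> (\<lambda>z. F z + G z) \<in> Linf_mat"
  by (auto simp: Linf_mat_def intro!: Linf_add)

lemma Linf_mat_diff:
  assumes "F \<in> Linf_mat" "G \<in> Linf_mat"
  shows "(\<lambda>z. F z - G z) \<in> Linf_mat"
proof -
  have "(\<lambda>z. F z $ i $ j + (-1) * G z $ i $ j) \<in> Linf" for i j
    using assms by (intro Linf_add Linf_mult Linf_const) (auto simp: Linf_mat_def)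
  then show ?thesis by (simp add: Linf_mat_def)
qed

lemma Linf_mat_const: "(\<lambda>z. A) \<in> Linf_mat"
  by (simp add: Linf_mat_def Linf_const)

lemma Linf_mat_adj: "F \<in> Linf_mat \<Longrightarrow> (\<lambda>z. mat_adj (F z)) \<in> Linf_mat"
  by (simp add: Linf_mat_def mat_adj_def Linf_cnj)

lemma Linf_mat_tilde: "F \<in> Linf_mat \<Longrightarrow> fun_tilde F \<in> Linf_mat"
  using Linf_cnj_arg[OF Linf_cnj, of "\<lambda>z. F z $ _ $ _"]
  by (simp add: Linf_mat_def mat_adj_def fun_tilde_def)

lemma Linf_mat_entry_integrable: "F \<in> Linf_mat \<Longrightarrow> integrable circle (\<lambda>z. F z $ i $ j)"
  by (simp add: Linf_mat_def Linf_Ltwo Ltwo_integrable)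

lemma analytic_mat_iff: "F \<in> Linf_mat \<Longrightarrow> analytic_mat F \<longleftrightarrow> (\<forall>k<0. mat_coeff F k = 0)"
  by (auto simp: analytic_mat_def mat_coeff_def vec_eq_iff Linf_mat_entry_integrable)

lemma mat_coeff_add: "F \<in> Linf_mat \<Longrightarrow> G \<in> Linf_mat \<Longrightarrow>
    mat_coeff (\<lambda>z. F z + G z) k = mat_coeff F k + mat_coeff G k"
  by (simp add: mat_coeff_def vec_eq_iff fourier_coeff_add Linf_mat_entry_integrable)

lemma mat_coeff_diff: "F \<in> Linf_mat \<Longrightarrow> G \<in> Linf_mat \<Longrightarrow>
    mat_coeff (\<lambda>z. F z - G z) k = mat_coeff F k - mat_coeff G k"
  by (simp add: mat_coeff_def vec_eq_iff fourier_coeff_diff Linf_mat_entry_integrable)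

lemma mat_coeff_mult_const: "F \<in> Linf_mat \<Longrightarrow> mat_coeff (\<lambda>z. F z ** A) k = mat_coeff F k ** A"
  by (simp add: mat_coeff_def matrix_matrix_mult_def vec_eq_iff fourier_coeff_sum
      fourier_coeff_cmult Linf_mat_entry_integrable mult.commute[of "_ $ _ $ _" "A $ _ $ _"]
      mult.commute[of "fourier_coeff _ _"])

lemma mat_coeff_const_mult: "F \<in> Linf_mat \<Longrightarrow> mat_coeff (\<lambda>z. A ** F z) k = A ** mat_coeff F k"
  by (simp add: mat_coeff_def matrix_matrix_mult_def vec_eq_iff fourier_coeff_sum
      fourier_coeff_cmult Linf_mat_entry_integrable)

lemma mat_coeff_adj: "mat_coeff (\<lambda>z. mat_adj (F z)) k = mat_adj (mat_coeff F (- k))"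
  by (simp add: mat_coeff_def mat_adj_def vec_eq_iff fourier_coeff_cnj)

text \<open>Conjugating the values and conjugating the argument each reverse the index, so the two
  reversals cancel, in contrast to the pointwise adjoint.\<close>

lemma mat_coeff_tilde:
  assumes "F \<in> Linf_mat"
  shows "mat_coeff (fun_tilde F) k = mat_adj (mat_coeff F k)"
proof -
  have m: "(\<lambda>z. cnj (F z $ j $ i)) \<in> borel_measurable circle" for i j
    using assms by (intro Ltwo_measurable Ltwo_cnj Linf_Ltwo) (simp add: Linf_mat_def)
  show ?thesis
    using fourier_coeff_cnj_arg[OF m]
    by (simp add: mat_coeff_def mat_adj_def fun_tilde_def vec_eq_iff fourier_coeff_cnj)
qed

lemma vec_coeff_mult_const: "f \<in> Ltwo_vec \<Longrightarrow> vec_coeff (\<lambda>z. A *v f z) k = A *v vec_coeff f k"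
  by (simp add: vec_coeff_def matrix_vector_mult_def vec_eq_iff fourier_coeff_sum
      fourier_coeff_cmult Ltwo_vec_def Ltwo_integrable Ltwo_cmult)

lemma vec_coeff_mult_spectrum:
  fixes \<iota> :: "nat \<Rightarrow> int" and F :: "complex \<Rightarrow> complex ^ 'n ^ 'n"
  assumes "inj \<iota>" "f \<in> Ltwo_vec" "F \<in> Linf_mat" "\<And>k. k \<notin> range \<iota> \<Longrightarrow> vec_coeff f k = 0"
  shows "(\<lambda>m. mat_coeff F (n - \<iota> m) *v vec_coeff f (\<iota> m)) sums vec_coeff (\<lambda>z. F z *v f z) n"
proof -
  have "(\<lambda>N. \<Sum>m<N. (mat_coeff F (n - \<iota> m) *v vec_coeff f (\<iota> m)) $ i)
      \<longlonglongrightarrow> vec_coeff (\<lambda>z. F z *v f z) n $ i" for i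
  proof -
    have "(\<lambda>m. \<Sum>j\<in>UNIV. fourier_coeff (\<lambda>z. F z $ i $ j) (n - \<iota> m) * fourier_coeff (\<lambda>z. f z $ j) (\<iota> m))
        sums (\<Sum>j\<in>UNIV. fourier_coeff (\<lambda>z. F z $ i $ j * f z $ j) n)"
      using assms
      by (intro sums_sum fourier_coeff_mult_spectrum)
         (auto simp: Ltwo_vec_def Linf_mat_def vec_coeff_def vec_eq_iff)
    also have "(\<Sum>j\<in>UNIV. fourier_coeff (\<lambda>z. F z $ i $ j * f z $ j) n) = fourier_coeff (\<lambda>z. (F z *v f z) $ i) n"
      using assms
      by (simp add: matrix_vector_mult_def fourier_coeff_sum Ltwo_integrable Linf_mult_Ltwo Ltwo_vec_def Linf_mat_def)
    finally show ?thesis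
      by (simp add: sums_def mat_coeff_def vec_coeff_def matrix_vector_mult_def)
  qed
  then show ?thesis
    unfolding sums_def by (intro vec_tendstoI) simp
qed

section \<open>Coefficients of Toeplitz and Hankel images\<close>

lemma hardy_proj_vec_Htwo_vec: "f \<in> Ltwo_vec \<Longrightarrow> hardy_proj_vec f \<in> Htwo_vec"
  by (simp add: Ltwo_vec_def Htwo_vec_def hardy_proj_vec_def hardy_proj_Htwo)

lemma vec_coeff_hardy_proj_vec:
  "f \<in> Ltwo_vec \<Longrightarrow> vec_coeff (hardy_proj_vec f) k = (if k \<ge> 0 then vec_coeff f k else 0)"
  by (simp add: Ltwo_vec_def vec_coeff_def hardy_proj_vec_def fourier_coeff_hardy_proj vec_eq_iff)

lemma Ltwo_vec_inner_hardy_proj_vec: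
  "f \<in> Ltwo_vec \<Longrightarrow> h \<in> Htwo_vec \<Longrightarrow> Ltwo_vec_inner (hardy_proj_vec f) h = Ltwo_vec_inner f h"
  by (simp add: Ltwo_vec_def Htwo_vec_def Ltwo_vec_inner_def hardy_proj_vec_def Ltwo_inner_hardy_proj)

lemma Ltwo_vec_inner_commute: "Ltwo_vec_inner g f = cnj (Ltwo_vec_inner f g)"
  unfolding Ltwo_vec_inner_def cnj_sum by (intro sum.cong refl Ltwo_inner_commute)

lemma Ltwo_vec_inner_hardy_proj_vec_right:
  "f \<in> Ltwo_vec \<Longrightarrow> h \<in> Htwo_vec \<Longrightarrow> Ltwo_vec_inner h (hardy_proj_vec f) = Ltwo_vec_inner h f"
  by (simp add: Ltwo_vec_inner_commute[of h] Ltwo_vec_inner_hardy_proj_vec)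

lemma Ltwo_vec_flip: "f \<in> Ltwo_vec \<Longrightarrow> (\<lambda>z. cnj z *s f (cnj z)) \<in> Ltwo_vec"
  using Ltwo_flip[of "\<lambda>z. f z $ _"] by (simp add: Ltwo_vec_def)

lemma vec_coeff_flip: "f \<in> Ltwo_vec \<Longrightarrow> vec_coeff (\<lambda>z. cnj z *s f (cnj z)) k = vec_coeff f (- k - 1)"
  using fourier_coeff_flip[of "\<lambda>z. f z $ _"] by (simp add: Ltwo_vec_def vec_coeff_def vec_eq_iff)

lemma toeplitz_Htwo_vec: "F \<in> Linf_mat \<Longrightarrow> f \<in> Ltwo_vec \<Longrightarrow> toeplitz F f \<in> Htwo_vec"
  unfolding toeplitz_def by (intro hardy_proj_vec_Htwo_vec Linf_mat_mult_vec)

lemma vec_coeff_toeplitz: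
  "F \<in> Linf_mat \<Longrightarrow> f \<in> Ltwo_vec \<Longrightarrow> k \<ge> 0 \<Longrightarrow> vec_coeff (toeplitz F f) k = vec_coeff (\<lambda>z. F z *v f z) k"
  unfolding toeplitz_def by (simp add: vec_coeff_hardy_proj_vec Linf_mat_mult_vec)

lemma hankel_Htwo_vec: "F \<in> Linf_mat \<Longrightarrow> f \<in> Ltwo_vec \<Longrightarrow> hankel F f \<in> Htwo_vec"
  unfolding hankel_def by (intro hardy_proj_vec_Htwo_vec Ltwo_vec_flip Linf_mat_mult_vec)

text \<open>The Hankel image lists in reverse exactly those coefficients of the product that the
  Toeplitz operator discards.\<close>

lemma vec_coeff_hankel:
  assumes "F \<in> Linf_mat" "f \<in> Ltwo_vec" "k \<ge> 0"
  shows "vec_coeff (hankel F f) k = vec_coeff (\<lambda>z. F z *v f z) (- k - 1)"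
proof -
  have "(\<lambda>z. F z *v f z) \<in> Ltwo_vec" using assms by (intro Linf_mat_mult_vec)
  from Ltwo_vec_flip[OF this] vec_coeff_flip[OF this] assms(3) show ?thesis
    unfolding hankel_def by (simp add: vec_coeff_hardy_proj_vec)
qed

section \<open>Adjoints of the operators\<close>

lemma Ltwo_inner_flip:
  assumes "u \<in> Ltwo" "v \<in> Ltwo"
  shows "Ltwo_inner (\<lambda>z. cnj z * u (cnj z)) v = Ltwo_inner u (\<lambda>z. cnj z * v (cnj z))"
proof -
  have m: "(\<lambda>z. (z * u z) * cnj (v (cnj z))) \<in> borel_measurable circle"
    using integrable_Ltwo_inner[OF Ltwo_mult_powi[OF assms(1), of 1] Ltwo_cnj_arg[OF assms(2)]]
    by (simp add: mult.commute borel_measurable_integrable)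
  show ?thesis
    using integral_circle_cnj[OF m] by (simp add: Ltwo_inner_def mult_ac)
qed

lemma Ltwo_vec_inner_flip:
  "u \<in> Ltwo_vec \<Longrightarrow> v \<in> Ltwo_vec \<Longrightarrow>
    Ltwo_vec_inner (\<lambda>z. cnj z *s u (cnj z)) v = Ltwo_vec_inner u (\<lambda>z. cnj z *s v (cnj z))"
  using Ltwo_inner_flip[of "\<lambda>z. u z $ _" "\<lambda>z. v z $ _"]
  by (simp add: Ltwo_vec_inner_def Ltwo_vec_def)

lemma Ltwo_vec_inner_mat_adj:
  assumes "F \<in> Linf_mat" "f \<in> Ltwo_vec" "g \<in> Ltwo_vec"
  shows "Ltwo_vec_inner (\<lambda>z. F z *v f z) g = Ltwo_vec_inner f (\<lambda>z. mat_adj (F z) *v g z)"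
proof -
  have i: "integrable circle (\<lambda>z. F z $ i $ j * f z $ j * cnj (g z $ i))" for i j
    using assms by (intro integrable_Ltwo_inner Linf_mult_Ltwo) (auto simp: Linf_mat_def Ltwo_vec_def)
  have i': "integrable circle (\<lambda>z. f z $ j * (F z $ i $ j * cnj (g z $ i)))" for i j
    using i[of i j] by (simp add: mult_ac)
  have "Ltwo_vec_inner (\<lambda>z. F z *v f z) g =
      (\<Sum>i\<in>UNIV. \<Sum>j\<in>UNIV. LINT z|circle. F z $ i $ j * f z $ j * cnj (g z $ i))"
    using i by (simp add: Ltwo_vec_inner_def Ltwo_inner_def matrix_vector_mult_def sum_distrib_right)
  also have "\<dots> = (\<Sum>j\<in>UNIV. \<Sum>i\<in>UNIV. LINT z|circle. f z $ j * (F z $ i $ j * cnj (g z $ i)))"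
    by (subst sum.swap) (simp add: mult_ac)
  also have "\<dots> = Ltwo_vec_inner f (\<lambda>z. mat_adj (F z) *v g z)"
    using i' by (simp add: Ltwo_vec_inner_def Ltwo_inner_def matrix_vector_mult_def mat_adj_def
        sum_distrib_left)
  finally show ?thesis .
qed

lemma Htwo_vec_monomial: "(\<lambda>z. z powi int k *s axis i 1) \<in> Htwo_vec"
proof -
  have "(\<lambda>z. z powi int k * axis i 1 $ j) \<in> Htwo" for j
    by (cases "i = j") (simp_all add: axis_def Htwo_zero Htwo_powi del: power_int_of_nat)
  then show ?thesis by (simp add: Htwo_vec_def)
qed

lemma Ltwo_vec_inner_monomial:
  "Ltwo_vec_inner f (\<lambda>z. z powi int k *s axis i 1) = vec_coeff f (int k) $ i"
proof -
  have "Ltwo_inner (\<lambda>z. f z $ j) (\<lambda>z. z powi int k * axis i 1 $ j) =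
      (if j = i then fourier_coeff (\<lambda>z. f z $ i) (int k) else 0)" for j
    by (simp add: axis_def Ltwo_inner_powi del: power_int_of_nat) (simp add: Ltwo_inner_def)
  then show ?thesis by (simp add: Ltwo_vec_inner_def vec_coeff_def)
qed

text \<open>An explicit candidate shows that the choice in \<open>hardy_adjoint\<close> succeeds.
  The chosen function may differ from it on a null set, but both pair alike with every vector
  monomial, which reads off a coordinate of a coefficient.\<close>

lemma hardy_adjoint_coeff:
  assumes "k \<in> Htwo_vec" "\<And>g. g \<in> Htwo_vec \<Longrightarrow> Ltwo_vec_inner (T g) h = Ltwo_vec_inner g k"
  shows "hardy_adjoint T h \<in> Htwo_vec" "vec_coeff (hardy_adjoint T h) l = vec_coeff k l"
proof -
  define k' where "k' = hardy_adjoint T h"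
  have *: "k' \<in> Htwo_vec \<and> (\<forall>g\<in>Htwo_vec. Ltwo_vec_inner (T g) h = Ltwo_vec_inner g k')"
    unfolding k'_def hardy_adjoint_def by (rule someI[of _ k]) (use assms in blast)
  then show "hardy_adjoint T h \<in> Htwo_vec" by (simp add: k'_def)
  have "vec_coeff k' l = vec_coeff k l"
  proof (cases "l < 0")
    case True
    then show ?thesis using * assms(1) by (simp add: vec_coeff_Htwo_vec)
  next
    case False
    then obtain m where m: "l = int m" using nonneg_int_cases[of l] by auto
    have "Ltwo_vec_inner g k' = Ltwo_vec_inner g k" if "g \<in> Htwo_vec" for g
      using * assms(2) that by metis
    then have "Ltwo_vec_inner k' g = Ltwo_vec_inner k g" if "g \<in> Htwo_vec" for g
      using that by (simp add: Ltwo_vec_inner_commute[of k'] Ltwo_vec_inner_commute[of k])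
    from this[OF Htwo_vec_monomial] show ?thesis
      by (simp only: m Ltwo_vec_inner_monomial vec_eq_iff) simp
  qed
  then show "vec_coeff (hardy_adjoint T h) l = vec_coeff k l" by (simp add: k'_def)
qed

lemma
  assumes F: "F \<in> Linf_mat" and h: "h \<in> Htwo_vec"
  shows hardy_adjoint_toeplitz_Htwo_vec: "hardy_adjoint (toeplitz F) h \<in> Htwo_vec"
    and vec_coeff_hardy_adjoint_toeplitz:
      "vec_coeff (hardy_adjoint (toeplitz F) h) l = vec_coeff (toeplitz (\<lambda>z. mat_adj (F z)) h) l"
proof -
  have k: "toeplitz (\<lambda>z. mat_adj (F z)) h \<in> Htwo_vec"
    using F h by (intro toeplitz_Htwo_vec Linf_mat_adj Htwo_vec_Ltwo_vec)
  have "Ltwo_vec_inner (toeplitz F g) h = Ltwo_vec_inner g (toeplitz (\<lambda>z. mat_adj (F z)) h)"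
    if "g \<in> Htwo_vec" for g
    using F h that unfolding toeplitz_def
    by (simp add: Ltwo_vec_inner_hardy_proj_vec Ltwo_vec_inner_hardy_proj_vec_right
        Linf_mat_mult_vec Linf_mat_adj Htwo_vec_Ltwo_vec Ltwo_vec_inner_mat_adj)
  from hardy_adjoint_coeff[OF k this]
  show "hardy_adjoint (toeplitz F) h \<in> Htwo_vec"
    "vec_coeff (hardy_adjoint (toeplitz F) h) l = vec_coeff (toeplitz (\<lambda>z. mat_adj (F z)) h) l"
    by auto
qed

lemma
  assumes F: "F \<in> Linf_mat" and h: "h \<in> Htwo_vec"
  shows hardy_adjoint_hankel_Htwo_vec: "hardy_adjoint (hankel F) h \<in> Htwo_vec"
    and vec_coeff_hardy_adjoint_hankel:
      "vec_coeff (hardy_adjoint (hankel F) h) l = vec_coeff (hankel (fun_tilde F) h) l"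
proof -
  have hL: "h \<in> Ltwo_vec" using h by (rule Htwo_vec_Ltwo_vec)
  have k: "hankel (fun_tilde F) h \<in> Htwo_vec"
    using F hL by (intro hankel_Htwo_vec Linf_mat_tilde)
  have "Ltwo_vec_inner (hankel F g) h = Ltwo_vec_inner g (hankel (fun_tilde F) h)"
    if g: "g \<in> Htwo_vec" for g
  proof -
    have Fg: "(\<lambda>z. F z *v g z) \<in> Ltwo_vec"
      using F g by (intro Linf_mat_mult_vec Htwo_vec_Ltwo_vec)
    have Fh: "(\<lambda>z. fun_tilde F z *v h z) \<in> Ltwo_vec"
      using F hL by (intro Linf_mat_mult_vec Linf_mat_tilde)
    have "Ltwo_vec_inner (hankel F g) h = Ltwo_vec_inner (\<lambda>z. F z *v g z) (\<lambda>z. cnj z *s h (cnj z))"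
      unfolding hankel_def using h hL Ltwo_vec_flip[OF Fg] Ltwo_vec_inner_flip[OF Fg hL]
      by (simp add: Ltwo_vec_inner_hardy_proj_vec)
    also have "\<dots> = Ltwo_vec_inner g (\<lambda>z. mat_adj (F z) *v (cnj z *s h (cnj z)))"
      by (rule Ltwo_vec_inner_mat_adj[OF F Htwo_vec_Ltwo_vec[OF g] Ltwo_vec_flip[OF hL]])
    \<comment> \<open>\<open>fun_tilde F\<close> at \<open>cnj z\<close> is the adjoint of
      \<open>F z\<close>: moving the flip outside turns the pointwise adjoint into the symbol
      \<open>fun_tilde F\<close>.\<close>
    also have "(\<lambda>z. mat_adj (F z) *v (cnj z *s h (cnj z))) = (\<lambda>z. cnj z *s (fun_tilde F (cnj z) *v h (cnj z)))"
      by (simp add: fun_tilde_def vector_scalar_commute)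
    also have "Ltwo_vec_inner g \<dots> = Ltwo_vec_inner g (hankel (fun_tilde F) h)"
      unfolding hankel_def using g Ltwo_vec_flip[OF Fh] by (simp add: Ltwo_vec_inner_hardy_proj_vec_right)
    finally show ?thesis .
  qed
  from hardy_adjoint_coeff[OF k this]
  show "hardy_adjoint (hankel F) h \<in> Htwo_vec"
    "vec_coeff (hardy_adjoint (hankel F) h) l = vec_coeff (hankel (fun_tilde F) h) l"
    by auto
qed

text \<open>Translates the operator identity into coefficient identities; negative indices
  contribute nothing in the Hardy space.\<close>

lemma Htwo_vec_AE_eq_iff:
  assumes "f \<in> Htwo_vec" "g \<in> Htwo_vec"
  shows "(AE z in circle. f z = g z) \<longleftrightarrow> (\<forall>l. vec_coeff f (int l) = vec_coeff g (int l))"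
proof
  assume *: "AE z in circle. f z = g z"
  have "fourier_coeff (\<lambda>z. f z $ i) k = fourier_coeff (\<lambda>z. g z $ i) k" for i k
    using * assms
    by (intro fourier_coeff_cong_AE) (auto simp: Htwo_vec_def intro: Ltwo_measurable Htwo_Ltwo)
  then show "\<forall>l. vec_coeff f (int l) = vec_coeff g (int l)"
    by (simp add: vec_coeff_def)
next
  assume *: "\<forall>l. vec_coeff f (int l) = vec_coeff g (int l)"
  have "AE z in circle. f z $ i = g z $ i" for i
  proof (rule Htwo_AE_eqI)
    fix k :: int assume "k \<ge> 0"
    then show "fourier_coeff (\<lambda>z. f z $ i) k = fourier_coeff (\<lambda>z. g z $ i) k"
      using *[rule_format, of "nat k"] by (simp add: vec_coeff_def vec_eq_iff)
  qed (use assms in \<open>simp_all add: Htwo_vec_def\<close>)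
  then have "AE z in circle. \<forall>i. f z $ i = g z $ i"
    by (simp add: eventually_all_finite)
  then show "AE z in circle. f z = g z"
    by (simp add: vec_eq_iff)
qed

section \<open>The matrix equation\<close>

lemma matrix_vector_mult_axis_nth: "(A *v axis j 1) $ i = A $ i $ j"
  for A :: "complex ^ 'n ^ 'm"
proof -
  have "(\<Sum>k\<in>UNIV. A $ i $ k * axis j 1 $ k) = (\<Sum>k\<in>UNIV. if k = j then A $ i $ k else 0)"
    by (rule sum.cong) (auto simp: axis_def)
  then show ?thesis by (simp add: matrix_vector_mult_def)
qed

lemma matrix_add_rdistrib: "(A + B) ** C = A ** C + B ** C"
  for A B :: "complex ^ 'n ^ 'm"
  by (simp add: matrix_matrix_mult_def vec_eq_iff distrib_right sum.distrib)

lemma mat_adj_mult: "mat_adj (A ** B) = mat_adj B ** mat_adj A"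
  by (simp add: mat_adj_def matrix_matrix_mult_def vec_eq_iff mult.commute)

lemma mat_adj_mat_adj [simp]: "mat_adj (mat_adj A) = A"
  by (simp add: mat_adj_def vec_eq_iff)

lemma mat_adj_add: "mat_adj (A + B) = mat_adj A + mat_adj B"
  by (simp add: mat_adj_def vec_eq_iff)

lemma mat_adj_zero [simp]: "mat_adj 0 = 0"
  by (simp add: mat_adj_def vec_eq_iff)

text \<open>Here \<bullet> is the real inner product, the real part of the Hermitian one, so the
  conjugate transpose is an adjoint for it as well.\<close>

lemma inner_mat_adj:
  fixes A :: "complex ^ 'n ^ 'm"
  shows "(A *v v) \<bullet> c = v \<bullet> (mat_adj A *v c)"
proof -
  have Re: "x \<bullet> y = Re (x * cnj y)" for x y :: complex
    by (simp add: inner_complex_def)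
  have "(A *v v) \<bullet> c = Re (\<Sum>i\<in>UNIV. \<Sum>j\<in>UNIV. A $ i $ j * v $ j * cnj (c $ i))"
    by (simp add: inner_vec_def Re matrix_vector_mult_def sum_distrib_right)
  also have "\<dots> = Re (\<Sum>j\<in>UNIV. \<Sum>i\<in>UNIV. v $ j * (A $ i $ j * cnj (c $ i)))"
    by (subst sum.swap) (simp add: mult_ac)
  also have "\<dots> = v \<bullet> (mat_adj A *v c)"
    by (simp add: inner_vec_def Re matrix_vector_mult_def mat_adj_def sum_distrib_left)
  finally show ?thesis .
qed

text \<open>Every \<open>B *v x\<close> lies in the common kernel of the adjoints, which is
  trivial.\<close>

lemma matrix_eq_0_of_adj_injective:
  fixes a :: "nat \<Rightarrow> complex ^ 'n ^ 'n"
  assumes inj: "\<forall>c. (\<forall>k. mat_adj (a k) *v c = 0) \<longrightarrow> c = 0"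
    and B: "\<And>k. mat_adj (a k) ** B = 0"
  shows "B = 0"
proof (rule matrix_eq[THEN iffD2], rule allI)
  fix x
  have "\<forall>k. mat_adj (a k) *v (B *v x) = 0"
    by (simp add: matrix_vector_mul_assoc B)
  with inj have "B *v x = 0" by blast
  then show "B *v x = 0 *v x" by simp
qed

text \<open>The vectors \<open>x\<close> for which \<open>b\<^sub>l x = a\<^sub>l\<^sup>* y\<close> has a solution \<open>y\<close> independent of \<open>l\<close> form a real
  subspace.  By the equation it contains the ranges of all \<open>a\<^sub>k\<close>, so a vector orthogonal to it is
  killed by all \<open>a\<^sub>k\<^sup>*\<close> and hence is zero.\<close>

lemma skew_factorization:
  fixes a b :: "nat \<Rightarrow> complex ^ 'n ^ 'n"
  assumes inj: "\<forall>c. (\<forall>k. mat_adj (a k) *v c = 0) \<longrightarrow> c = 0"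
    and eq: "\<And>k l. b l ** a k + mat_adj (a l) ** mat_adj (b k) = 0"
  obtains A where "mat_adj A = - A" "\<And>l. b l = mat_adj (a l) ** A"
proof -
  define W where "W = {x. \<exists>y. \<forall>l. b l *v x = mat_adj (a l) *v y}"
  have "subspace W"
  proof (rule subspaceI)
    show "0 \<in> W" unfolding W_def by (auto intro: exI[of _ 0])
    show "x + x' \<in> W" if "x \<in> W" "x' \<in> W" for x x'
    proof -
      from that obtain y y' where "\<forall>l. b l *v x = mat_adj (a l) *v y" "\<forall>l. b l *v x' = mat_adj (a l) *v y'"
        by (auto simp: W_def)
      then have "\<forall>l. b l *v (x + x') = mat_adj (a l) *v (y + y')"
        by (simp add: matrix_vector_right_distrib)
      then show ?thesis unfolding W_def by blast
    qed
    show "r *\<^sub>R x \<in> W" if "x \<in> W" for r x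
    proof -
      from that obtain y where "\<forall>l. b l *v x = mat_adj (a l) *v y"
        by (auto simp: W_def)
      then have "\<forall>l. b l *v (r *\<^sub>R x) = mat_adj (a l) *v (r *\<^sub>R y)"
        by (simp add: linear_cmul[OF matrix_vector_mul_linear])
      then show ?thesis unfolding W_def by blast
    qed
  qed
  have aW: "a k *v v \<in> W" for k v
  proof -
    \<comment> \<open>The equation itself supplies the solution \<open>y\<close>, and it does not
      involve \<open>l\<close>.\<close>
    have "b l *v (a k *v v) = mat_adj (a l) *v (- (mat_adj (b k) *v v))" for l
      using arg_cong[OF eq[of l k], of "\<lambda>M. M *v v"]
      by (simp add: matrix_vector_mult_add_rdistrib matrix_vector_mul_assoc[symmetric]
          eq_neg_iff_add_eq_0 linear_neg[OF matrix_vector_mul_linear])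
    then show ?thesis unfolding W_def by blast
  qed
  have "W = UNIV"
  proof (rule ccontr)
    assume "W \<noteq> UNIV"
    then have "span W \<subset> span UNIV"
      using \<open>subspace W\<close> by (auto simp: span_eq_iff[THEN iffD2])
    then obtain c where c: "c \<noteq> 0" "\<And>y. y \<in> span W \<Longrightarrow> orthogonal c y"
      using orthogonal_to_subspace_exists_gen by blast
    have "mat_adj (a k) *v c = 0" for k
    proof -
      \<comment> \<open>Orthogonality of \<open>c\<close> to \<open>a k *v v\<close> for this
        particular \<open>v\<close> says that \<open>v\<close> has norm 0.\<close>
      define v where "v = mat_adj (a k) *v c"
      have "(a k *v v) \<bullet> c = 0"
        using c(2)[OF span_base[OF aW]] by (simp add: orthogonal_def inner_commute)
      then have "v \<bullet> v = 0" by (simp add: inner_mat_adj v_def)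
      then show ?thesis by (simp add: v_def)
    qed
    with inj c(1) show False by blast
  qed
  then have "\<forall>j. \<exists>y. \<forall>l. b l *v axis j 1 = mat_adj (a l) *v y"
    unfolding W_def by blast
  then obtain y where y: "\<And>j l. b l *v axis j 1 = mat_adj (a l) *v y j"
    by metis
  \<comment> \<open>The columns are the solutions for the basis vectors, so the factorization holds
    column by column.\<close>
  define A where "A = (\<chi> i j. y j $ i)"
  have bA: "b l = mat_adj (a l) ** A" for l
  proof -
    have "b l $ i $ j = (mat_adj (a l) ** A) $ i $ j" for i j
      using arg_cong[OF y[of l j], of "\<lambda>x. x $ i"]
      unfolding matrix_vector_mult_axis_nth
      by (simp add: A_def matrix_matrix_mult_def matrix_vector_mult_def)
    then show ?thesis by (simp add: vec_eq_iff)
  qed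
  have "mat_adj (a l) ** ((A + mat_adj A) ** a k) = 0" for k l
  proof -
    have "mat_adj (a l) ** ((A + mat_adj A) ** a k) =
        (mat_adj (a l) ** A) ** a k + mat_adj (a l) ** (mat_adj A ** a k)"
      by (simp only: matrix_add_rdistrib matrix_add_ldistrib matrix_mul_assoc)
    also have "\<dots> = b l ** a k + mat_adj (a l) ** mat_adj (b k)"
      by (simp only: bA mat_adj_mult mat_adj_mat_adj)
    finally show ?thesis using eq[of l k] by simp
  qed
  then have "(A + mat_adj A) ** a k = 0" for k
    by (rule matrix_eq_0_of_adj_injective[of a, OF inj])
  \<comment> \<open>\<open>A + mat_adj A\<close> is self-adjoint, so taking adjoints moves
    \<open>a k\<close> to the left as \<open>mat_adj (a k)\<close> and the kernel argument applies a
    second time.\<close>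
  from arg_cong[OF this, of mat_adj] have "mat_adj (a k) ** (A + mat_adj A) = 0" for k
    by (simp add: mat_adj_mult mat_adj_add add.commute)
  then have "A + mat_adj A = 0"
    by (rule matrix_eq_0_of_adj_injective[of a, OF inj])
  then have "mat_adj A = - A"
    by (simp add: eq_neg_iff_add_eq_0 add.commute)
  then show ?thesis using bA by (rule that)
qed

section \<open>Products of Toeplitz and Hankel operators\<close>

text \<open>The coefficient of index \<open>k\<close> of the projected matrix is the adjoint of the
  coefficient of \<phi> at \<open>neg_index k\<close>. A vector killed by all of them makes a
  combination of the columns with vanishing coefficients, hence null, and regularity
  applies.\<close>

lemma regular_mat_hardy_proj_injective:
  fixes \<phi> :: "complex \<Rightarrow> complex ^ 'n ^ 'n"
  assumes \<phi>: "\<phi> \<in> Linf_mat"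
    and reg: "regular_mat (hardy_proj_mat (\<lambda>z. \<chi> i j. cnj z * mat_adj (\<phi> z) $ i $ j))"
    and c: "\<And>k. mat_adj (mat_coeff \<phi> (neg_index k)) *v c = 0"
  shows "c = 0"
proof -
  define f where "f i j z = cnj z * cnj (\<phi> z $ j $ i)" for i j z
  have fz: "f i j z = cnj (\<phi> z $ j $ i * z powi 1)" for i j z
    by (simp add: f_def)
  have \<phi>L: "(\<lambda>z. \<phi> z $ j $ i) \<in> Ltwo" for i j
    using \<phi> by (simp add: Linf_mat_def Linf_Ltwo)
  have f: "f i j \<in> Ltwo" for i j
    unfolding fz[abs_def] by (intro Ltwo_cnj Ltwo_mult_powi \<phi>L)
  have fc: "fourier_coeff (f i j) k = cnj (fourier_coeff (\<lambda>z. \<phi> z $ j $ i) (- k - 1))" for i j k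
    unfolding fz[abs_def] by (simp only: fourier_coeff_cnj fourier_coeff_mult_powi)
  have PL: "hardy_proj (f i j) \<in> Ltwo" for i j
    by (intro Htwo_Ltwo hardy_proj_Htwo f)
  have "AE z in circle. (\<Sum>j\<in>UNIV. c $ j * hardy_proj (f i j) z) = 0" for i
  proof (rule Ltwo_AE_eqI)
    show "(\<lambda>z. \<Sum>j\<in>UNIV. c $ j * hardy_proj (f i j) z) \<in> Ltwo"
      by (intro Ltwo_sum Ltwo_cmult PL)
    fix k
    have "fourier_coeff (\<lambda>z. \<Sum>j\<in>UNIV. c $ j * hardy_proj (f i j) z) k =
        (\<Sum>j\<in>UNIV. c $ j * fourier_coeff (hardy_proj (f i j)) k)"
      by (simp add: fourier_coeff_sum Ltwo_integrable Ltwo_cmult PL fourier_coeff_cmult)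
    also have "\<dots> = 0"
    proof (cases "k \<ge> 0")
      case True
      then have k: "- k - 1 = neg_index (nat k)" by (simp add: neg_index_def)
      have "(\<Sum>j\<in>UNIV. c $ j * fourier_coeff (hardy_proj (f i j)) k) =
          (mat_adj (mat_coeff \<phi> (neg_index (nat k))) *v c) $ i"
        using True
        by (simp add: fourier_coeff_hardy_proj f fc k matrix_vector_mult_def mat_adj_def mat_coeff_def mult.commute)
      then show ?thesis by (simp add: c)
    qed (simp add: fourier_coeff_hardy_proj f)
    finally show "fourier_coeff (\<lambda>z. \<Sum>j\<in>UNIV. c $ j * hardy_proj (f i j) z) k = fourier_coeff (\<lambda>z. 0) k"
      by (simp add: fourier_coeff_def)
  qed (rule Ltwo_const)
  then have "AE z in circle. \<forall>i. (\<Sum>j\<in>UNIV. c $ j * hardy_proj (f i j) z) = 0"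
    by (simp add: eventually_all_finite)
  then have "AE z in circle. (\<Sum>j\<in>UNIV. c $ j *s column j (hardy_proj_mat (\<lambda>z. \<chi> i j. cnj z * mat_adj (\<phi> z) $ i $ j) z)) = 0"
    by (simp add: vec_eq_iff column_def hardy_proj_mat_def mat_adj_def f_def[abs_def])
  then have "\<forall>j. c $ j = 0"
    using reg unfolding regular_mat_def by blast
  then show ?thesis by (simp add: vec_eq_iff)
qed

lemma vec_coeff_mult_monomial:
  "F \<in> Linf_mat \<Longrightarrow> vec_coeff (\<lambda>z. F z *v (z powi m *s axis i 1)) n = mat_coeff F (n - m) *v axis i 1"
  by (simp add: vec_coeff_def mat_coeff_def vec_eq_iff vector_scalar_commute
      matrix_vector_mult_axis_nth mult.commute[of "_ powi _"] fourier_coeff_mult_powi)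

lemma vec_coeff_mult_shift:
  "vec_coeff (\<lambda>z. F z *v (z *s h z)) n = vec_coeff (\<lambda>z. F z *v h z) (n - 1)"
  using fourier_coeff_mult_powi[of "\<lambda>z. (F z *v h z) $ _" 1]
  by (simp add: vec_coeff_def vec_eq_iff vector_scalar_commute mult.commute)

lemma Htwo_vec_shift:
  assumes "h \<in> Htwo_vec"
  shows "(\<lambda>z. z *s h z) \<in> Htwo_vec"
proof -
  have "(\<lambda>z. h z $ i * z powi 1) \<in> Htwo" for i
  proof -
    have "(\<lambda>z. h z $ i) \<in> Htwo"
      using assms by (simp add: Htwo_vec_def)
    then show ?thesis
      unfolding Htwo_def mem_Collect_eq fourier_coeff_mult_powi using Ltwo_mult_powi[of "\<lambda>z. h z $ i" 1] by auto
  qed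
  then show ?thesis by (simp add: Htwo_vec_def mult.commute)
qed

text \<open>The Toeplitz step keeps the coefficients of \<open>\<phi> h\<close> at indices
  \<open>int m\<close>. The Hankel step pairs them with the coefficient of \<psi> at
  \<open>- l - 1 - m\<close>, which depends on \<open>l + m\<close> alone.\<close>

lemma hankel_toeplitz_sums:
  assumes "\<phi> \<in> Linf_mat" "\<psi> \<in> Linf_mat" "h \<in> Ltwo_vec"
  shows "(\<lambda>m. mat_coeff \<psi> (neg_index (l + m)) *v vec_coeff (\<lambda>z. \<phi> z *v h z) (int m)) sums
    vec_coeff (hankel \<psi> (toeplitz \<phi> h)) (int l)"
proof -
  have T: "toeplitz \<phi> h \<in> Htwo_vec" using assms by (intro toeplitz_Htwo_vec)
  have "(\<lambda>m. mat_coeff \<psi> (neg_index l - int m) *v vec_coeff (toeplitz \<phi> h) (int m)) sums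
      vec_coeff (\<lambda>z. \<psi> z *v toeplitz \<phi> h z) (neg_index l)"
    using assms T
    by (intro vec_coeff_mult_spectrum) (auto simp: range_int_nat vec_coeff_Htwo_vec Htwo_vec_Ltwo_vec)
  moreover have "neg_index l - int m = neg_index (l + m)" "- int l - 1 = neg_index l" for m
    by (simp_all add: neg_index_def)
  ultimately show ?thesis
    using assms T by (simp add: vec_coeff_toeplitz vec_coeff_hankel Htwo_vec_Ltwo_vec)
qed

lemma toeplitz_hankel_sums:
  assumes "\<phi> \<in> Linf_mat" "\<psi> \<in> Linf_mat" "h \<in> Ltwo_vec"
  shows "(\<lambda>m. mat_adj (mat_coeff \<phi> (int m - int l)) *v vec_coeff (\<lambda>z. \<psi> z *v h z) (neg_index m)) sums
    vec_coeff (toeplitz (\<lambda>z. mat_adj (\<phi> z)) (hankel \<psi> h)) (int l)"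
proof -
  have H: "hankel \<psi> h \<in> Htwo_vec" using assms by (intro hankel_Htwo_vec)
  have "(\<lambda>m. mat_coeff (\<lambda>z. mat_adj (\<phi> z)) (int l - int m) *v vec_coeff (hankel \<psi> h) (int m)) sums
      vec_coeff (\<lambda>z. mat_adj (\<phi> z) *v hankel \<psi> h z) (int l)"
    using assms H
    by (intro vec_coeff_mult_spectrum)
       (auto simp: range_int_nat vec_coeff_Htwo_vec Htwo_vec_Ltwo_vec Linf_mat_adj)
  then show ?thesis
    using assms H
    by (simp add: vec_coeff_toeplitz vec_coeff_hankel Htwo_vec_Ltwo_vec neg_index_def Linf_mat_adj mat_coeff_adj)
qed

text \<open>Multiplication by \<open>z\<close> lifts the coefficient of \<open>\<phi> h\<close> at
  -1 to index 0, where it survives the projection and becomes the term \<open>m = 0\<close>; the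
  later terms form the series of row \<open>Suc l\<close> for \<open>h\<close>.\<close>

lemma hankel_toeplitz_shift:
  assumes "\<phi> \<in> Linf_mat" "\<psi> \<in> Linf_mat" "h \<in> Htwo_vec"
  shows "vec_coeff (hankel \<psi> (toeplitz \<phi> (\<lambda>z. z *s h z))) (int l) =
    mat_coeff \<psi> (neg_index l) *v vec_coeff (\<lambda>z. \<phi> z *v h z) (- 1) +
    vec_coeff (hankel \<psi> (toeplitz \<phi> h)) (int (Suc l))"
proof -
  define f where "f m = mat_coeff \<psi> (neg_index (l + m)) *v vec_coeff (\<lambda>z. \<phi> z *v h z) (int m - 1)" for m
  have "f sums vec_coeff (hankel \<psi> (toeplitz \<phi> (\<lambda>z. z *s h z))) (int l)"
    using hankel_toeplitz_sums[OF assms(1,2) Htwo_vec_Ltwo_vec[OF Htwo_vec_shift[OF assms(3)]], of l]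
    unfolding vec_coeff_mult_shift f_def[abs_def] .
  moreover have "(\<lambda>m. f (Suc m)) sums vec_coeff (hankel \<psi> (toeplitz \<phi> h)) (int (Suc l))"
    using hankel_toeplitz_sums[OF assms(1,2) Htwo_vec_Ltwo_vec[OF assms(3)], of "Suc l"]
    by (simp add: f_def)
  then have "f sums (vec_coeff (hankel \<psi> (toeplitz \<phi> h)) (int (Suc l)) + f 0)"
    by (rule sums_Suc)
  ultimately have "vec_coeff (hankel \<psi> (toeplitz \<phi> (\<lambda>z. z *s h z))) (int l) =
      vec_coeff (hankel \<psi> (toeplitz \<phi> h)) (int (Suc l)) + f 0"
    by (rule sums_unique2)
  then show ?thesis by (simp add: f_def)
qed

text \<open>Here the Hankel operator loses the coefficient of \<open>\<psi> h\<close> at -1 when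
  \<open>z\<close> lifts it to index 0. It is the term \<open>m = 0\<close> of row
  \<open>Suc l\<close> for \<open>h\<close>; the later terms form row \<open>l\<close> for
  \<open>z h\<close>.\<close>

lemma toeplitz_hankel_shift:
  assumes "\<phi> \<in> Linf_mat" "\<psi> \<in> Linf_mat" "h \<in> Htwo_vec"
  shows "vec_coeff (toeplitz (\<lambda>z. mat_adj (\<phi> z)) (hankel \<psi> h)) (int (Suc l)) =
    mat_adj (mat_coeff \<phi> (neg_index l)) *v vec_coeff (\<lambda>z. \<psi> z *v h z) (- 1) +
    vec_coeff (toeplitz (\<lambda>z. mat_adj (\<phi> z)) (hankel \<psi> (\<lambda>z. z *s h z))) (int l)"
proof -
  define f where "f m = mat_adj (mat_coeff \<phi> (int m - int (Suc l))) *v vec_coeff (\<lambda>z. \<psi> z *v h z) (neg_index m)" for m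
  have idx: "neg_index m - 1 = neg_index (Suc m)" "int (Suc m) - int (Suc l) = int m - int l"
    "int 0 - int (Suc l) = neg_index l" "neg_index 0 = - 1" for m
    by (simp_all add: neg_index_def)
  have "f sums vec_coeff (toeplitz (\<lambda>z. mat_adj (\<phi> z)) (hankel \<psi> h)) (int (Suc l))"
    using toeplitz_hankel_sums[OF assms(1,2) Htwo_vec_Ltwo_vec[OF assms(3)], of "Suc l"]
    unfolding f_def[abs_def] .
  moreover have "(\<lambda>m. f (Suc m)) sums
      vec_coeff (toeplitz (\<lambda>z. mat_adj (\<phi> z)) (hankel \<psi> (\<lambda>z. z *s h z))) (int l)"
    using toeplitz_hankel_sums[OF assms(1,2) Htwo_vec_Ltwo_vec[OF Htwo_vec_shift[OF assms(3)]], of l]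
    unfolding f_def vec_coeff_mult_shift idx .
  then have "f sums (vec_coeff (toeplitz (\<lambda>z. mat_adj (\<phi> z)) (hankel \<psi> (\<lambda>z. z *s h z))) (int l) + f 0)"
    by (rule sums_Suc)
  ultimately have "vec_coeff (toeplitz (\<lambda>z. mat_adj (\<phi> z)) (hankel \<psi> h)) (int (Suc l)) =
      vec_coeff (toeplitz (\<lambda>z. mat_adj (\<phi> z)) (hankel \<psi> (\<lambda>z. z *s h z))) (int l) + f 0"
    by (rule sums_unique2)
  then show ?thesis by (simp only: f_def idx add.commute)
qed

text \<open>Split \<open>w = A \<phi> h\<close> into its projection \<open>p\<close> and the rest \<open>q\<close>.  The coefficients of
  \<open>fun_tilde \<phi> p\<close> are those of the first product because \<open>b\<^sub>l = a\<^sub>l\<^sup>* A\<close>; those of \<open>fun_tilde \<phi> q\<close> are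
  minus those of the second one because \<open>fun_tilde \<psi> h\<close> and \<open>- A \<phi> h\<close> have the same negative
  coefficients.\<close>

lemma hankel_toeplitz_diff:
  fixes A :: "complex ^ 'n ^ 'n"
  assumes \<phi>: "\<phi> \<in> Linf_mat" and \<psi>: "\<psi> \<in> Linf_mat" and h: "h \<in> Htwo_vec"
    and A: "mat_adj A = - A"
    and b: "\<And>l. mat_coeff \<psi> (neg_index l) = mat_adj (mat_coeff \<phi> (neg_index l)) ** A"
  shows "vec_coeff (hankel \<psi> (toeplitz \<phi> h)) (int l) -
      vec_coeff (toeplitz (\<lambda>z. mat_adj (\<phi> z)) (hankel (fun_tilde \<psi>) h)) (int l) =
    vec_coeff (\<lambda>z. (fun_tilde \<phi> z ** A ** \<phi> z) *v h z) (neg_index l)"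
proof -
  note hL = Htwo_vec_Ltwo_vec[OF h]
  define u where "u z = \<phi> z *v h z" for z
  have u: "u \<in> Ltwo_vec" unfolding u_def using \<phi> hL by (rule Linf_mat_mult_vec)
  define w where "w z = A *v u z" for z
  have w: "w \<in> Ltwo_vec" unfolding w_def by (intro Linf_mat_mult_vec[OF Linf_mat_const] u)
  have wc: "vec_coeff w k = A *v vec_coeff u k" for k
    unfolding w_def using u by (rule vec_coeff_mult_const)
  define p where "p = hardy_proj_vec w"
  have p: "p \<in> Htwo_vec" unfolding p_def using w by (rule hardy_proj_vec_Htwo_vec)
  define q where "q z = w z - p z" for z
  have q: "q \<in> Ltwo_vec"
    using w Htwo_vec_Ltwo_vec[OF p] by (simp add: q_def Ltwo_vec_def Ltwo_diff)
  have qc: "vec_coeff q k = (if k < 0 then vec_coeff w k else 0)" for k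
  proof -
    have "vec_coeff q k = vec_coeff w k - vec_coeff p k"
      using w Htwo_vec_Ltwo_vec[OF p]
      by (simp add: q_def vec_coeff_def vec_eq_iff Ltwo_vec_def fourier_coeff_diff Ltwo_integrable)
    then show ?thesis by (simp add: p_def vec_coeff_hardy_proj_vec w)
  qed
  \<comment> \<open>With \<open>h\<close> in the Hardy space, a negative output index involves only
    negative coefficients of the symbol. There the adjoint of the factorization and
    \<open>mat_adj A = - A\<close> apply.\<close>
  have v: "vec_coeff (\<lambda>z. fun_tilde \<psi> z *v h z) (neg_index r) = - (A *v vec_coeff u (neg_index r))" for r
  proof -
    have neg: "neg_index r - int m = neg_index (r + m)" for m by (simp add: neg_index_def)
    have "(\<lambda>m. mat_coeff \<phi> (neg_index r - int m) *v vec_coeff h (int m)) sums vec_coeff u (neg_index r)"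
      unfolding u_def using \<phi> h hL
      by (intro vec_coeff_mult_spectrum) (auto simp: range_int_nat vec_coeff_Htwo_vec)
    from bounded_linear.sums[OF matrix_vector_mul_bounded_linear this, of "- A"]
    have "(\<lambda>m. - A *v (mat_coeff \<phi> (neg_index (r + m)) *v vec_coeff h (int m))) sums (- A *v vec_coeff u (neg_index r))"
      by (simp only: neg)
    moreover have "(\<lambda>m. mat_coeff (fun_tilde \<psi>) (neg_index r - int m) *v vec_coeff h (int m)) sums
        vec_coeff (\<lambda>z. fun_tilde \<psi> z *v h z) (neg_index r)"
      using Linf_mat_tilde[OF \<psi>] h hL
      by (intro vec_coeff_mult_spectrum) (auto simp: range_int_nat vec_coeff_Htwo_vec)
    ultimately have "vec_coeff (\<lambda>z. fun_tilde \<psi> z *v h z) (neg_index r) = - A *v vec_coeff u (neg_index r)"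
      by (simp add: neg mat_coeff_tilde \<psi> b mat_adj_mult A matrix_vector_mul_assoc sums_unique2)
    then show ?thesis
      by (simp add: matrix_vector_mult_def vec_eq_iff sum_negf)
  qed
  have 1: "vec_coeff (\<lambda>z. fun_tilde \<phi> z *v p z) (neg_index l) = vec_coeff (hankel \<psi> (toeplitz \<phi> h)) (int l)"
  proof -
    have "(\<lambda>m. mat_coeff (fun_tilde \<phi>) (neg_index l - int m) *v vec_coeff p (int m)) sums
        vec_coeff (\<lambda>z. fun_tilde \<phi> z *v p z) (neg_index l)"
      using Linf_mat_tilde[OF \<phi>] p
      by (intro vec_coeff_mult_spectrum) (auto simp: range_int_nat vec_coeff_Htwo_vec Htwo_vec_Ltwo_vec)
    moreover have "mat_coeff (fun_tilde \<phi>) (neg_index l - int m) *v vec_coeff p (int m) =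
        mat_coeff \<psi> (neg_index (l + m)) *v vec_coeff u (int m)" for m
    proof -
      have "neg_index l - int m = neg_index (l + m)" by (simp add: neg_index_def)
      then show ?thesis
        by (simp add: p_def vec_coeff_hardy_proj_vec w wc b mat_coeff_tilde \<phi> matrix_vector_mul_assoc)
    qed
    ultimately show ?thesis
      using hankel_toeplitz_sums[OF \<phi> \<psi> hL, of l] by (simp add: u_def[abs_def] sums_unique2)
  qed
  have 2: "vec_coeff (\<lambda>z. fun_tilde \<phi> z *v q z) (neg_index l) =
      - vec_coeff (toeplitz (\<lambda>z. mat_adj (\<phi> z)) (hankel (fun_tilde \<psi>) h)) (int l)"
  proof -
    have "(\<lambda>m. mat_coeff (fun_tilde \<phi>) (neg_index l - neg_index m) *v vec_coeff q (neg_index m)) sums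
        vec_coeff (\<lambda>z. fun_tilde \<phi> z *v q z) (neg_index l)"
      using Linf_mat_tilde[OF \<phi>] q
      by (intro vec_coeff_mult_spectrum inj_neg_index) (auto simp: range_neg_index qc)
    \<comment> \<open>The difference of two negative indices can have any sign, so the
      factorization, known at negative indices, says nothing about this symbol coefficient; it is
      used on the vector factor, through \<open>v\<close>.\<close>
    moreover have "mat_coeff (fun_tilde \<phi>) (neg_index l - neg_index m) *v vec_coeff q (neg_index m) =
        - (mat_adj (mat_coeff \<phi> (int m - int l)) *v vec_coeff (\<lambda>z. fun_tilde \<psi> z *v h z) (neg_index m))" for m
    proof -
      have "neg_index l - neg_index m = int m - int l" "neg_index m < 0"
        by (simp_all add: neg_index_def)
      then show ?thesis
        by (simp add: qc wc v mat_coeff_tilde \<phi> linear_neg[OF matrix_vector_mul_linear])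
    qed
    ultimately show ?thesis
      using sums_minus[OF toeplitz_hankel_sums[OF \<phi> Linf_mat_tilde[OF \<psi>] hL, of l]]
      by (simp add: sums_unique2)
  qed
  have "vec_coeff (\<lambda>z. (fun_tilde \<phi> z ** A ** \<phi> z) *v h z) (neg_index l) =
      vec_coeff (\<lambda>z. fun_tilde \<phi> z *v p z + fun_tilde \<phi> z *v q z) (neg_index l)"
    by (simp add: q_def w_def u_def matrix_vector_mul_assoc[symmetric] flip: matrix_vector_right_distrib)
  also have "\<dots> = vec_coeff (\<lambda>z. fun_tilde \<phi> z *v p z) (neg_index l) + vec_coeff (\<lambda>z. fun_tilde \<phi> z *v q z) (neg_index l)"
    using Linf_mat_mult_vec[OF Linf_mat_tilde[OF \<phi>] Htwo_vec_Ltwo_vec[OF p]]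
      Linf_mat_mult_vec[OF Linf_mat_tilde[OF \<phi>] q]
    by (simp add: vec_coeff_def vec_eq_iff Ltwo_vec_def fourier_coeff_add Ltwo_integrable)
  finally show ?thesis by (simp add: 1 2)
qed

text \<open>Replacing both adjoints by explicit operators takes one extra step: the chosen adjoint
  \<open>k\<close> and \<open>hankel (fun_tilde \<psi>) h\<close> are known to agree only in their
  coefficients. The coefficients of a Toeplitz image are series in those of its argument, so this
  agreement is enough.\<close>

lemma hankel_toeplitz_commute_iff:
  fixes \<phi> \<psi> :: "complex \<Rightarrow> complex ^ 'n ^ 'n"
  assumes \<phi>: "\<phi> \<in> Linf_mat" and \<psi>: "\<psi> \<in> Linf_mat"
  shows "(\<forall>h\<in>Htwo_vec. AE z in circle.
      hankel \<psi> (toeplitz \<phi> h) z = hardy_adjoint (toeplitz \<phi>) (hardy_adjoint (hankel \<psi>) h) z) \<longleftrightarrow>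
    (\<forall>h\<in>Htwo_vec. \<forall>l. vec_coeff (hankel \<psi> (toeplitz \<phi> h)) (int l) =
      vec_coeff (toeplitz (\<lambda>z. mat_adj (\<phi> z)) (hankel (fun_tilde \<psi>) h)) (int l))"
proof (intro ball_cong refl)
  fix h :: "complex \<Rightarrow> complex ^ 'n" assume h: "h \<in> Htwo_vec"
  define k where "k = hardy_adjoint (hankel \<psi>) h"
  have k: "k \<in> Htwo_vec" "\<And>l. vec_coeff k l = vec_coeff (hankel (fun_tilde \<psi>) h) l"
    unfolding k_def using \<psi> h
    by (simp_all add: hardy_adjoint_hankel_Htwo_vec vec_coeff_hardy_adjoint_hankel)
  have H: "hankel (fun_tilde \<psi>) h \<in> Htwo_vec"
    using \<psi> h by (intro hankel_Htwo_vec Linf_mat_tilde Htwo_vec_Ltwo_vec)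
  have "vec_coeff (toeplitz (\<lambda>z. mat_adj (\<phi> z)) k) (int l) =
      vec_coeff (toeplitz (\<lambda>z. mat_adj (\<phi> z)) (hankel (fun_tilde \<psi>) h)) (int l)" for l
  proof -
    have "(\<lambda>m. mat_coeff (\<lambda>z. mat_adj (\<phi> z)) (int l - int m) *v vec_coeff f (int m)) sums
        vec_coeff (toeplitz (\<lambda>z. mat_adj (\<phi> z)) f) (int l)" if "f \<in> Htwo_vec" for f
    proof -
      have "(\<lambda>m. mat_coeff (\<lambda>z. mat_adj (\<phi> z)) (int l - int m) *v vec_coeff f (int m)) sums
          vec_coeff (\<lambda>z. mat_adj (\<phi> z) *v f z) (int l)"
        using \<phi> that
        by (intro vec_coeff_mult_spectrum)
           (auto simp: range_int_nat vec_coeff_Htwo_vec Htwo_vec_Ltwo_vec Linf_mat_adj)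
      then show ?thesis
        using \<phi> that by (simp add: vec_coeff_toeplitz Htwo_vec_Ltwo_vec Linf_mat_adj)
    qed
    from this[OF k(1)] this[OF H] show ?thesis
      unfolding k(2) by (rule sums_unique2)
  qed
  moreover have "hankel \<psi> (toeplitz \<phi> h) \<in> Htwo_vec" "hardy_adjoint (toeplitz \<phi>) k \<in> Htwo_vec"
    using \<phi> \<psi> h k(1)
    by (auto intro: hankel_Htwo_vec toeplitz_Htwo_vec Htwo_vec_Ltwo_vec hardy_adjoint_toeplitz_Htwo_vec)
  ultimately show "(AE z in circle. hankel \<psi> (toeplitz \<phi> h) z = hardy_adjoint (toeplitz \<phi>) (hardy_adjoint (hankel \<psi>) h) z) \<longleftrightarrow>
    (\<forall>l. vec_coeff (hankel \<psi> (toeplitz \<phi> h)) (int l) =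
      vec_coeff (toeplitz (\<lambda>z. mat_adj (\<phi> z)) (hankel (fun_tilde \<psi>) h)) (int l))"
    using \<phi> k(1) by (simp add: k_def[symmetric] Htwo_vec_AE_eq_iff vec_coeff_hardy_adjoint_toeplitz)
qed

lemma all_neg_iff_neg_index: "(\<forall>k<0. P k) \<longleftrightarrow> (\<forall>l. P (neg_index l))"
  by (auto simp flip: range_neg_index)

theorem theorem2p9:
  fixes \<phi> \<psi> :: "complex \<Rightarrow> complex ^ 'n ^ 'n"
  assumes "\<phi> \<in> Linf_mat" and "\<psi> \<in> Linf_mat"
    and "regular_mat (hardy_proj_mat (\<lambda>z. \<chi> i j. cnj z * mat_adj (\<phi> z) $ i $ j))"
  shows "(\<forall>h\<in>Htwo_vec. AE z in circle.
            hankel \<psi> (toeplitz \<phi> h) z = hardy_adjoint (toeplitz \<phi>) (hardy_adjoint (hankel \<psi>) h) z)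
    \<longleftrightarrow> (\<exists>A :: complex ^ 'n ^ 'n.
            analytic_mat (\<lambda>z. \<psi> z + fun_tilde \<phi> z ** mat_adj A) \<and>
            analytic_mat (\<lambda>z. fun_tilde \<psi> z - mat_adj A ** \<phi> z) \<and>
            analytic_mat (\<lambda>z. fun_tilde \<phi> z ** A ** \<phi> z))"
proof -
  note \<phi> = assms(1) and \<psi> = assms(2)
  define a where "a k = mat_coeff \<phi> (neg_index k)" for k
  define b where "b k = mat_coeff \<psi> (neg_index k)" for k
  define L where "L h l = vec_coeff (hankel \<psi> (toeplitz \<phi> h)) (int l)" for h l
  define R where "R h l = vec_coeff (toeplitz (\<lambda>z. mat_adj (\<phi> z)) (hankel (fun_tilde \<psi>) h)) (int l)" for h l
  have inj: "\<forall>c. (\<forall>k. mat_adj (a k) *v c = 0) \<longrightarrow> c = 0"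
    using regular_mat_hardy_proj_injective[OF \<phi> assms(3)] unfolding a_def by blast
  have i: "analytic_mat (\<lambda>z. \<psi> z + fun_tilde \<phi> z ** mat_adj A) \<longleftrightarrow>
      (\<forall>l. b l + mat_adj (a l) ** mat_adj A = 0)" for A
    using \<phi> \<psi>
    by (simp add: analytic_mat_iff Linf_mat_add Linf_mat_mult Linf_mat_tilde Linf_mat_const
        all_neg_iff_neg_index mat_coeff_add mat_coeff_mult_const mat_coeff_tilde a_def b_def)
  have ii: "analytic_mat (\<lambda>z. fun_tilde \<psi> z - mat_adj A ** \<phi> z) \<longleftrightarrow>
      (\<forall>l. mat_adj (b l) = mat_adj A ** a l)" for A
    using \<phi> \<psi>
    by (simp add: analytic_mat_iff Linf_mat_diff Linf_mat_mult Linf_mat_tilde Linf_mat_const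
        all_neg_iff_neg_index mat_coeff_diff mat_coeff_const_mult mat_coeff_tilde a_def b_def)
  have F: "(\<lambda>z. fun_tilde \<phi> z ** A ** \<phi> z) \<in> Linf_mat" for A
    using \<phi> by (intro Linf_mat_mult Linf_mat_tilde Linf_mat_const)
  have iii: "analytic_mat (\<lambda>z. fun_tilde \<phi> z ** A ** \<phi> z) \<longleftrightarrow>
      (\<forall>l. mat_coeff (\<lambda>z. fun_tilde \<phi> z ** A ** \<phi> z) (neg_index l) = 0)" for A
    using F by (simp add: analytic_mat_iff all_neg_iff_neg_index)
  have diff: "L h l - R h l = vec_coeff (\<lambda>z. (fun_tilde \<phi> z ** A ** \<phi> z) *v h z) (neg_index l)"
    if "h \<in> Htwo_vec" "mat_adj A = - A" "\<And>l. b l = mat_adj (a l) ** A" for h l A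
    unfolding L_def R_def using \<phi> \<psi> that by (intro hankel_toeplitz_diff) (auto simp: a_def b_def)
  have "(\<forall>h\<in>Htwo_vec. \<forall>l. L h l = R h l) \<longleftrightarrow> (\<exists>A.
      (\<forall>l. b l + mat_adj (a l) ** mat_adj A = 0) \<and> (\<forall>l. mat_adj (b l) = mat_adj A ** a l) \<and>
      (\<forall>l. mat_coeff (\<lambda>z. fun_tilde \<phi> z ** A ** \<phi> z) (neg_index l) = 0))"
  proof
    assume LR: "\<forall>h\<in>Htwo_vec. \<forall>l. L h l = R h l"
    have "(b l ** a k + mat_adj (a l) ** mat_adj (b k)) *v axis i 1 = 0" for k l i
    proof -
      \<comment> \<open>For this monomial the coefficients at -1 in the boundary terms are column
        \<open>i\<close> of \<open>a k\<close> and of \<open>mat_adj (b k)\<close>.\<close>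
      define h where "h z = z powi int k *s axis i (1::complex)" for z
      have h: "h \<in> Htwo_vec" unfolding h_def by (rule Htwo_vec_monomial)
      have neg: "- 1 - int k = neg_index k" by (simp add: neg_index_def)
      have "b l *v vec_coeff (\<lambda>z. \<phi> z *v h z) (- 1) + L h (Suc l) = L (\<lambda>z. z *s h z) l"
        unfolding L_def b_def using hankel_toeplitz_shift[OF \<phi> \<psi> h] by simp
      moreover have "R h (Suc l) = mat_adj (a l) *v vec_coeff (\<lambda>z. fun_tilde \<psi> z *v h z) (- 1) + R (\<lambda>z. z *s h z) l"
        unfolding R_def a_def using toeplitz_hankel_shift[OF \<phi> Linf_mat_tilde[OF \<psi>] h] by simp
      ultimately have "b l *v vec_coeff (\<lambda>z. \<phi> z *v h z) (- 1) +
          mat_adj (a l) *v vec_coeff (\<lambda>z. fun_tilde \<psi> z *v h z) (- 1) = 0"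
        using LR h Htwo_vec_shift[OF h] by (simp add: algebra_simps)
      then show ?thesis
        unfolding h_def vec_coeff_mult_monomial[OF \<phi>] vec_coeff_mult_monomial[OF Linf_mat_tilde[OF \<psi>]] neg
        by (simp add: mat_coeff_tilde \<psi> a_def b_def matrix_vector_mult_add_rdistrib matrix_vector_mul_assoc)
    qed
    then have "b l ** a k + mat_adj (a l) ** mat_adj (b k) = 0" for k l
      by (simp add: matrix_vector_mult_axis_nth vec_eq_iff)
    from skew_factorization[of a b, OF inj this]
    obtain A where A: "mat_adj A = - A" "\<And>l. b l = mat_adj (a l) ** A" by blast
    \<comment> \<open>Constant vectors, the monomials of exponent 0, already reveal every negative
      coefficient of the symbol.\<close>
    have "mat_coeff (\<lambda>z. fun_tilde \<phi> z ** A ** \<phi> z) (neg_index l) *v axis i 1 = 0" for l i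
      using diff[OF Htwo_vec_monomial[of 0 i] A] LR Htwo_vec_monomial[of 0 i]
        vec_coeff_mult_monomial[OF F, of A 0 i "neg_index l"] by simp
    then have "mat_coeff (\<lambda>z. fun_tilde \<phi> z ** A ** \<phi> z) (neg_index l) = 0" for l
      by (simp add: matrix_vector_mult_axis_nth vec_eq_iff)
    moreover have "b l + mat_adj (a l) ** mat_adj A = 0" for l
      using A(2)[of l] matrix_add_ldistrib[of "mat_adj (a l)" A "mat_adj A"] by (simp add: A(1))
    ultimately show "\<exists>A. (\<forall>l. b l + mat_adj (a l) ** mat_adj A = 0) \<and> (\<forall>l. mat_adj (b l) = mat_adj A ** a l) \<and>
      (\<forall>l. mat_coeff (\<lambda>z. fun_tilde \<phi> z ** A ** \<phi> z) (neg_index l) = 0)"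
      using A(2) by (intro exI[of _ A]) (auto simp: mat_adj_mult)
  next
    assume "\<exists>A. (\<forall>l. b l + mat_adj (a l) ** mat_adj A = 0) \<and> (\<forall>l. mat_adj (b l) = mat_adj A ** a l) \<and>
      (\<forall>l. mat_coeff (\<lambda>z. fun_tilde \<phi> z ** A ** \<phi> z) (neg_index l) = 0)"
    then obtain A where A: "\<And>l. b l + mat_adj (a l) ** mat_adj A = 0" "\<And>l. mat_adj (b l) = mat_adj A ** a l"
      "\<And>l. mat_coeff (\<lambda>z. fun_tilde \<phi> z ** A ** \<phi> z) (neg_index l) = 0" by blast
    \<comment> \<open>The adjoint of (ii). Inserted into (i), it leaves \<open>mat_adj (a l)\<close>
      times \<open>A + mat_adj A\<close> equal to 0, whence \<open>A\<close> is
      skew-adjoint.\<close>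
    have bA: "b l = mat_adj (a l) ** A" for l
      using arg_cong[OF A(2)[of l], of mat_adj] by (simp add: mat_adj_mult)
    have "A + mat_adj A = 0"
      by (rule matrix_eq_0_of_adj_injective[of a, OF inj])
         (use A(1) in \<open>simp_all add: bA matrix_add_ldistrib\<close>)
    then have skew: "mat_adj A = - A"
      by (simp add: eq_neg_iff_add_eq_0 add.commute)
    show "\<forall>h\<in>Htwo_vec. \<forall>l. L h l = R h l"
    proof (intro ballI allI)
      fix h :: "complex \<Rightarrow> complex ^ 'n" and l assume h: "h \<in> Htwo_vec"
      \<comment> \<open>All symbol indices in this series are negative, so (iii) makes every term
        vanish.\<close>
      have "(\<lambda>m. mat_coeff (\<lambda>z. fun_tilde \<phi> z ** A ** \<phi> z) (neg_index l - int m) *v vec_coeff h (int m)) sums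
          vec_coeff (\<lambda>z. (fun_tilde \<phi> z ** A ** \<phi> z) *v h z) (neg_index l)"
        using h F by (intro vec_coeff_mult_spectrum) (auto simp: range_int_nat vec_coeff_Htwo_vec Htwo_vec_Ltwo_vec)
      moreover have "neg_index l - int m = neg_index (l + m)" for m by (simp add: neg_index_def)
      ultimately have "vec_coeff (\<lambda>z. (fun_tilde \<phi> z ** A ** \<phi> z) *v h z) (neg_index l) = 0"
        by (simp add: A(3) sums_unique2[OF _ sums_zero])
      with diff[OF h skew bA, of l] show "L h l = R h l" by simp
    qed
  qed
  then show ?thesis
    unfolding hankel_toeplitz_commute_iff[OF \<phi> \<psi>] i ii iii L_def R_def .
qed

end
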